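(* Under the Setting and Standing Assumptions below, let $(w^k)_{k\in\mathbb{N}}=(x^k,y^k)_{k\in\mathbb{N}}$ be the random sequence generated by SPDHG. Then $(w^k)_{k\in\mathbb{N}}$ converges almost surely to a saddle point of $\min_{x\in X}\max_{y\in Y}\mathcal{L}(x,y)$, where $\mathcal{L}(x,y)=\sum_{i=1}^n \big(\langle A_ix,y_i\rangle - f_i^*(y_i)\big) + g(x)$.
   Context: Setting. $X$ and $Y_1,\dots,Y_n$ are finite-dimensional real Hilbert spaces, $Y=\prod_{i=1}^n Y_i$ with the product inner product, $A_i:X\to Y_i$ are linear operators, and $A:X\to Y$, $Ax=(A_1x,\dots,A_nx)$, with adjoint $A^T y=\sum_i A_i^T y_i$. The functionals $g:X\to\mathbb{R}\cup\{\infty\}$ and $f_i:Y_i\to\mathbb{R}\cup\{\infty\}$ are convex, proper and lower semicontinuous; $f_i^*$ is the convex conjugate of $f_i$. A saddle point is a pair $\hat w=(\hat x,\hat y)\in X\times Y$ with $\mathcal{L}(\hat x,y)\le\mathcal{L}(\hat x,\hat y)\le\mathcal{L}(x,\hat y)$ for all $x\in X$, $y\in Y$. For a functional $h$ and $\sigma>0$, $\mathrm{prox}_{\sigma h}(v)=\arg\min_u \tfrac12\|v-u\|^2+\sigma h(u)$. SPDHG: fix probabilities $p_1,\dots,p_n>0$ with $\sum_i p_i=1$, step sizes $\tau,\sigma_1,\dots,\sigma_n>0$, and $x^0\in X$; set $y^0=0\in Y$, $z^0=\bar z^0=0\in X$. For $k\ge0$: draw $j^k\in\{1,\dots,n\}$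 independently of the past with $\mathbb{P}(j^k=i)=p_i$; set $x^{k+1}=\mathrm{prox}_{\tau g}(x^k-\tau\bar z^k)$; $y_i^{k+1}=\mathrm{prox}_{\sigma_i f_i^*}(y_i^k+\sigma_iA_ix^{k+1})$ if $i=j^k$ and $y_i^{k+1}=y_i^k$ otherwise; $\delta^k=A_{j^k}^T(y^{k+1}_{j^k}-y^k_{j^k})$; $z^{k+1}=z^k+\delta^k$; $\bar z^{k+1}=z^{k+1}+p_{j^k}^{-1}\delta^k$. Write $w^k=(x^k,y^k)$. Standing Assumptions: the set of saddle points is nonempty, and $\tau\sigma_i\|A_i\|^2<p_i$ for every $i$. *)

theory Defs
  imports "HOL-Analysis.Analysis" "HOL-Probability.Probability"
begin

text \<open>Extended-real valued functionals on a (sub)space S of a Euclidean space.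
  The spaces Y_i are modelled as linear subspaces S_i of a common Euclidean type.\<close>

definition ext_convex_on :: "'a::real_vector set \<Rightarrow> ('a \<Rightarrow> ereal) \<Rightarrow> bool" where
  "ext_convex_on S f \<longleftrightarrow>
     (\<forall>x\<in>S. \<forall>y\<in>S. \<forall>t::real. 0 \<le> t \<and> t \<le> 1 \<longrightarrow>
        f ((1 - t) *\<^sub>R x + t *\<^sub>R y) \<le> ereal (1 - t) * f x + ereal t * f y)"

definition proper_on :: "'a set \<Rightarrow> ('a \<Rightarrow> ereal) \<Rightarrow> bool" where
  "proper_on S f \<longleftrightarrow> (\<forall>x\<in>S. f x \<noteq> -\<infinity>) \<and> (\<exists>x\<in>S. f x \<noteq> \<infinity>)"

definition lsc_on :: "'a::topological_space set \<Rightarrow> ('a \<Rightarrow> ereal) \<Rightarrow> bool" where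
  "lsc_on S f \<longleftrightarrow>
     (\<forall>x\<in>S. \<forall>u. (\<forall>k. u k \<in> S) \<and> u \<longlonglongrightarrow> x \<longrightarrow> f x \<le> liminf (\<lambda>k. f (u k)))"

definition conj_on :: "'a::real_inner set \<Rightarrow> ('a \<Rightarrow> ereal) \<Rightarrow> 'a \<Rightarrow> ereal" where
  "conj_on S f y = (SUP u\<in>S. ereal (u \<bullet> y) - f u)"

definition prox_on :: "'a::real_normed_vector set \<Rightarrow> real \<Rightarrow> ('a \<Rightarrow> ereal) \<Rightarrow> 'a \<Rightarrow> 'a" where
  "prox_on S \<sigma> h v = (THE u. u \<in> S \<and>
     (\<forall>w\<in>S. ereal ((norm (v - u))\<^sup>2 / 2) + ereal \<sigma> * h u
            \<le> ereal ((norm (v - w))\<^sup>2 / 2) + ereal \<sigma> * h w))"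

definition lagrangian ::
  "nat \<Rightarrow> (nat \<Rightarrow> 'y::real_inner set) \<Rightarrow> (nat \<Rightarrow> 'x \<Rightarrow> 'y) \<Rightarrow> ('x \<Rightarrow> ereal)
   \<Rightarrow> (nat \<Rightarrow> 'y \<Rightarrow> ereal) \<Rightarrow> 'x \<Rightarrow> (nat \<Rightarrow> 'y) \<Rightarrow> ereal" where
  "lagrangian n S A g f x y =
     (\<Sum>i\<in>{1..n}. ereal (A i x \<bullet> y i) - conj_on (S i) (f i) (y i)) + g x"

definition in_Y :: "nat \<Rightarrow> (nat \<Rightarrow> 'y set) \<Rightarrow> (nat \<Rightarrow> 'y) \<Rightarrow> bool" where
  "in_Y n S y \<longleftrightarrow> (\<forall>i\<in>{1..n}. y i \<in> S i)"

definition saddle_point ::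
  "nat \<Rightarrow> (nat \<Rightarrow> 'y::real_inner set) \<Rightarrow> (nat \<Rightarrow> 'x \<Rightarrow> 'y) \<Rightarrow> ('x \<Rightarrow> ereal)
   \<Rightarrow> (nat \<Rightarrow> 'y \<Rightarrow> ereal) \<Rightarrow> 'x \<Rightarrow> (nat \<Rightarrow> 'y) \<Rightarrow> bool" where
  "saddle_point n S A g f xh yh \<longleftrightarrow> in_Y n S yh \<and>
     (\<forall>x y. in_Y n S y \<longrightarrow>
        lagrangian n S A g f xh y \<le> lagrangian n S A g f xh yh \<and>
        lagrangian n S A g f xh yh \<le> lagrangian n S A g f x yh)"

text \<open>SPDHG iterates (x^k, y^k, z^k, zbar^k) for a given realisation js of the index sequence.\<close>
primrec spdhg ::
  "(nat \<Rightarrow> 'y::real_inner set) \<Rightarrow> (nat \<Rightarrow> 'x::real_inner \<Rightarrow> 'y) \<Rightarrow> ('x \<Rightarrow> ereal)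
   \<Rightarrow> (nat \<Rightarrow> 'y \<Rightarrow> ereal) \<Rightarrow> (nat \<Rightarrow> real) \<Rightarrow> real \<Rightarrow> (nat \<Rightarrow> real) \<Rightarrow> 'x
   \<Rightarrow> (nat \<Rightarrow> nat) \<Rightarrow> nat \<Rightarrow> 'x \<times> (nat \<Rightarrow> 'y) \<times> 'x \<times> 'x" where
  "spdhg S A g f p \<tau> \<sigma> x0 js 0 = (x0, (\<lambda>i. 0), 0, 0)"
| "spdhg S A g f p \<tau> \<sigma> x0 js (Suc k) =
     (let (x, y, z, zb) = spdhg S A g f p \<tau> \<sigma> x0 js k;
          x' = prox_on UNIV \<tau> g (x - \<tau> *\<^sub>R zb);
          j = js k;
          yj' = prox_on (S j) (\<sigma> j) (conj_on (S j) (f j)) (y j + \<sigma> j *\<^sub>R A j x');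
          y' = y(j := yj');
          \<delta> = adjoint (A j) (yj' - y j);
          z' = z + \<delta>;
          zb' = z' + (1 / p j) *\<^sub>R \<delta>
      in (x', y', z', zb'))"

end

theory Submission
  imports Defs
begin

text \<open>
  Saddle points are the pairs \<open>(xs, ys)\<close> with \<open>- AT ys\<close> a subgradient of \<open>g\<close> at \<open>xs\<close> and \<open>A i xs\<close> a
  subgradient of the conjugate of \<open>f i\<close> at \<open>ys i\<close>. For each of them, monotonicity of the subdifferentials
  along the proximal steps shows that the squared weighted distance to \<open>(xs, ys)\<close>, corrected by a cross
  term and a quadratic term in the extrapolation \<open>zb - z\<close>, is a nonnegative supermartingale whose expected
  decrease controls \<open>x\<^sup>k\<^sup>+\<^sup>1 - x\<^sup>k\<close> and every candidate dual increment.
  The expected decreases are summable, so almost surely these increments tend to zero and every cluster point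
  of the iterates is a saddle point; and the supermartingale converges almost surely by counting upcrossings.
  Doing this simultaneously for a countable dense set of saddle points gives convergence of the distance
  to saddle points arbitrarily close to any given cluster point, hence of the whole sequence.
\<close>

subsection \<open>Subgradients, proximal points and conjugates\<close>

text \<open>The limit is random, and each saddle point brings its own exceptional null set. Since
  there may be uncountably many saddle points, the limit cannot be fixed before discarding null
  sets; this is what forces the countable dense set. Once a single null set is removed, the
  remaining argument is deterministic.

  Filtrations and conditional expectations are avoided. A state is a deterministic map applied to
  the previous state and a fresh index, so conditioning on the past becomes a finite sum weighted by
  \<open>p\<close>. Measurability is automatic, because the first \<open>k\<close> draws take values
  in a countable type, and integrals in \<open>ennreal\<close> need no integrability.

  The strict step size condition enters only through a constant \<gamma> < 1 with \<open>\<tau> *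
  \<sigma> i * (onorm (A i))\<^sup>2 \<le> \<gamma>\<^sup>2 * p i\<close>. The extrapolation costs a
  fraction \<gamma> of the primal decrease and the random dual step a fraction \<gamma> of the dual
  one; the rest, 1 - \<gamma>, is what makes increments summable.\<close>

definition subgrad_on :: "'a::real_inner set \<Rightarrow> ('a \<Rightarrow> ereal) \<Rightarrow> 'a \<Rightarrow> 'a \<Rightarrow> bool" where
  "subgrad_on S h u v \<longleftrightarrow>
     u \<in> S \<and> \<bar>h u\<bar> \<noteq> \<infinity> \<and> (\<forall>w\<in>S. h u + ereal (v \<bullet> (w - u)) \<le> h w)"

text \<open>Each subgradient inequality is tested at the base point of the other and the two are
  added. Finiteness of both values, part of \<open>subgrad_on\<close>, lets them cancel.\<close>

lemma subgrad_on_monotone: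
  assumes "subgrad_on S h u v" "subgrad_on S h u' v'"
  shows "0 \<le> (v - v') \<bullet> (u - u')"
proof -
  obtain a a' where a: "h u = ereal a" "h u' = ereal a'"
    using assms by (auto simp: subgrad_on_def)
  have "h u + ereal (v \<bullet> (u' - u)) \<le> h u'" "h u' + ereal (v' \<bullet> (u - u')) \<le> h u"
    using assms by (auto simp: subgrad_on_def)
  then have "a + v \<bullet> (u' - u) \<le> a'" "a' + v' \<bullet> (u - u') \<le> a"
    using a by auto
  then show ?thesis by (simp add: inner_diff)
qed

text \<open>In the subgradient inequality the linear term converges and lower semicontinuity handles
  the values of \<open>h\<close>. Applied to the optimality conditions of proximal steps, this
  identifies cluster points as saddle points.\<close>

lemma subgrad_on_closed:
  assumes S: "closed S" and h: "proper_on S h" "lsc_on S h"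
    and sg: "\<And>k. subgrad_on S h (u k) (v k)"
    and u: "u \<longlonglongrightarrow> u'" and v: "v \<longlonglongrightarrow> v'"
  shows "subgrad_on S h u' v'"
proof -
  have uS: "u k \<in> S" for k using sg by (auto simp: subgrad_on_def)
  then have u'S: "u' \<in> S" using S u closed_sequentially by blast
  have lsc: "h u' \<le> liminf (\<lambda>k. h (u k))"
    using h(2) uS u u'S by (auto simp: lsc_on_def)
  have ineq: "h u' + ereal (v' \<bullet> (w - u')) \<le> h w" if w: "w \<in> S" for w
  proof -
    have lim: "(\<lambda>k. ereal (v k \<bullet> (w - u k))) \<longlonglongrightarrow> ereal (v' \<bullet> (w - u'))"
      by (intro tendsto_intros u v)
    have "h u' + ereal (v' \<bullet> (w - u')) \<le> ereal (v' \<bullet> (w - u')) + liminf (\<lambda>k. h (u k))"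
      using add_left_mono[OF lsc, of "ereal (v' \<bullet> (w - u'))"]
      by (subst add.commute)
    also have "\<dots> = liminf (\<lambda>k. ereal (v k \<bullet> (w - u k)) + h (u k))"
      by (rule ereal_liminf_lim_add[OF lim, symmetric]) simp
    also have "\<dots> \<le> liminf (\<lambda>k::nat. h w)"
      using sg w by (intro Liminf_mono) (auto simp: subgrad_on_def add.commute)
    also have "\<dots> = h w" by (simp add: Liminf_const)
    finally show ?thesis .
  qed
  \<comment> \<open>Testing at a point of the effective domain excludes the value \<infinity> at the
    limit.\<close>
  obtain w where w: "w \<in> S" "h w \<noteq> \<infinity>" using h(1) by (auto simp: proper_on_def)
  have "h u' \<noteq> \<infinity>" using ineq[OF w(1)] w(2) by auto
  moreover have "h u' \<noteq> -\<infinity>" using h(1) u'S by (auto simp: proper_on_def)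
  ultimately show ?thesis using u'S ineq by (auto simp: subgrad_on_def)
qed

section \<open>Existence and characterisation of proximal points\<close>

lemma lsc_on_attains_inf:
  fixes \<phi> :: "'a::metric_space \<Rightarrow> ereal"
  assumes "lsc_on S \<phi>" "compact K" "K \<noteq> {}" "K \<subseteq> S"
  shows "\<exists>u\<in>K. \<forall>w\<in>K. \<phi> u \<le> \<phi> w"
proof -
  obtain s where s: "\<And>k. s k \<in> \<phi> ` K" "s \<longlonglongrightarrow> Inf (\<phi> ` K)"
    using Inf_as_limit[of "\<phi> ` K"] assms(3) by auto
  then have "\<forall>k. \<exists>u\<in>K. s k = \<phi> u" by blast
  then obtain u where u: "\<And>k. u k \<in> K" "\<And>k. s k = \<phi> (u k)" by metis
  obtain l r where l: "l \<in> K" "strict_mono r" "(u \<circ> r) \<longlonglongrightarrow> l"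
    using assms(2) u(1) by (meson compact_imp_seq_compact seq_compactE)
  have "\<phi> l \<le> liminf (\<lambda>k. \<phi> ((u \<circ> r) k))"
    using assms l u(1) unfolding lsc_on_def by (metis comp_apply subsetD)
  also have "(\<lambda>k. \<phi> ((u \<circ> r) k)) = s \<circ> r" using u(2) by auto
  also have "liminf (s \<circ> r) = Inf (\<phi> ` K)"
    using LIMSEQ_subseq_LIMSEQ[OF s(2) l(2)] lim_imp_Liminf trivial_limit_sequentially by blast
  finally show ?thesis using l(1) by (auto intro!: bexI[of _ l] intro: order_trans Inf_lower)
qed

lemma lsc_on_prox_objective:
  fixes h :: "'a::real_normed_vector \<Rightarrow> ereal"
  assumes "lsc_on S h" "0 \<le> \<sigma>"
  shows "lsc_on S (\<lambda>u. ereal ((norm (v - u))\<^sup>2 / 2) + ereal \<sigma> * h u)"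
  unfolding lsc_on_def
proof (intro ballI allI impI)
  fix x u assume x: "x \<in> S" and u: "(\<forall>k. u k \<in> S) \<and> u \<longlonglongrightarrow> x"
  have lim: "(\<lambda>k. ereal ((norm (v - u k))\<^sup>2 / 2)) \<longlonglongrightarrow> ereal ((norm (v - x))\<^sup>2 / 2)"
    using u by (intro tendsto_intros) auto
  have "ereal \<sigma> * h x \<le> ereal \<sigma> * liminf (\<lambda>k. h (u k))"
    using assms x u by (intro ereal_mult_left_mono) (auto simp: lsc_on_def)
  also have "\<dots> = liminf (\<lambda>k. ereal \<sigma> * h (u k))"
    using assms(2) by (intro Liminf_ereal_mult_left[symmetric]) auto
  finally have "ereal ((norm (v - x))\<^sup>2 / 2) + ereal \<sigma> * h x
      \<le> ereal ((norm (v - x))\<^sup>2 / 2) + liminf (\<lambda>k. ereal \<sigma> * h (u k))"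
    by (rule add_left_mono)
  also have "\<dots> = liminf (\<lambda>k. ereal ((norm (v - u k))\<^sup>2 / 2) + ereal \<sigma> * h (u k))"
    by (rule ereal_liminf_lim_add[OF lim, symmetric]) simp
  finally show "ereal ((norm (v - x))\<^sup>2 / 2) + ereal \<sigma> * h x
      \<le> liminf (\<lambda>k. ereal ((norm (v - u k))\<^sup>2 / 2) + ereal \<sigma> * h (u k))" .
qed

lemma proper_on_real:
  assumes "proper_on S h" "w \<in> S" "h w \<noteq> \<infinity>"
  obtains b where "h w = ereal b"
  using assms by (cases "h w") (auto simp: proper_on_def)

text \<open>A linear lower bound without separation theorems: \<open>h\<close> has a minimum
  \<open>m\<close> on the compact unit ball around a domain point \<open>u0\<close>, and convexity
  along the segment from \<open>u0\<close> to a distant \<open>w\<close> forbids falling faster than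
  the slope \<open>a - m\<close>.\<close>

lemma convex_lower_bound:
  fixes h :: "'a::euclidean_space \<Rightarrow> ereal"
  assumes S: "subspace S" and h: "ext_convex_on S h" "proper_on S h" "lsc_on S h"
  obtains u0 a c where "u0 \<in> S" "h u0 = ereal a" "0 \<le> c"
    "\<And>w b. w \<in> S \<Longrightarrow> h w = ereal b \<Longrightarrow> 1 \<le> norm (w - u0) \<Longrightarrow> a - c * norm (w - u0) \<le> b"
proof -
  obtain u0 where u0: "u0 \<in> S" "h u0 \<noteq> \<infinity>" using h(2) by (auto simp: proper_on_def)
  obtain a where a: "h u0 = ereal a" using proper_on_real[OF h(2) u0] .
  define K where "K = S \<inter> cball u0 1"
  have K: "compact K" "K \<noteq> {}" "K \<subseteq> S" "u0 \<in> K"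
    using u0 closed_subspace[OF S] by (auto simp: K_def)
  obtain l where l: "l \<in> K" "\<And>w. w \<in> K \<Longrightarrow> h l \<le> h w"
    using lsc_on_attains_inf[OF h(3) K(1-3)] by blast
  have "h l \<noteq> \<infinity>" using l(2)[OF K(4)] a by auto
  then obtain m where m: "h l = ereal m" using proper_on_real[OF h(2)] l(1) K(3) by blast
  have ma: "m \<le> a" using l(2)[OF K(4)] m a by auto
  have bound: "a - (a - m) * norm (w - u0) \<le> b"
    if w: "w \<in> S" "h w = ereal b" "1 \<le> norm (w - u0)" for w b
  proof -
    define r where "r = norm (w - u0)"
    define t where "t = 1 / r"
    have r: "1 \<le> r" using w(3) by (simp add: r_def)
    then have t: "0 \<le> t" "t \<le> 1" by (auto simp: t_def)
    \<comment> \<open>The point where the segment from \<open>u0\<close> to \<open>w\<close> crosses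
      the unit sphere around \<open>u0\<close>.\<close>
    define w' where "w' = (1 - t) *\<^sub>R u0 + t *\<^sub>R w"
    have "w' \<in> S" unfolding w'_def using S u0(1) w(1) by (intro subspace_add subspace_scale)
    moreover have "w' - u0 = t *\<^sub>R (w - u0)" by (simp add: w'_def algebra_simps)
    then have "norm (w' - u0) = t * r" using t by (simp add: r_def)
    then have "norm (w' - u0) = 1" using r by (simp add: t_def)
    ultimately have "w' \<in> K" by (auto simp: K_def dist_norm norm_minus_commute)
    then have "ereal m \<le> h w'" using l m by metis
    also have "h w' \<le> ereal (1 - t) * h u0 + ereal t * h w"
      using h(1) u0(1) w(1) t unfolding w'_def ext_convex_on_def by blast
    finally have "m \<le> (1 - t) * a + t * b" using a w(2) by simp
    then have "r * m \<le> r * ((1 - t) * a + t * b)" using r by (intro mult_left_mono) auto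
    also have "\<dots> = (r - 1) * a + b" using r by (simp add: t_def field_simps)
    finally show ?thesis unfolding r_def[symmetric] by (simp add: algebra_simps)
  qed
  show thesis by (rule that[OF u0(1) a, of "a - m"]) (use ma bound in auto)
qed

text \<open>The quadratic term beats the linear decrease of \<open>h\<close>, so outside a large
  ball the objective is no smaller than at its centre, and the minimum over the ball is
  global.\<close>

lemma prox_minimizer_exists:
  fixes h :: "'a::euclidean_space \<Rightarrow> ereal"
  assumes S: "subspace S" and h: "ext_convex_on S h" "proper_on S h" "lsc_on S h" and \<sigma>: "0 < \<sigma>"
  shows "\<exists>u\<in>S. \<forall>w\<in>S. ereal ((norm (v - u))\<^sup>2 / 2) + ereal \<sigma> * h u
            \<le> ereal ((norm (v - w))\<^sup>2 / 2) + ereal \<sigma> * h w"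
proof -
  obtain u0 a c where u0: "u0 \<in> S" "h u0 = ereal a" and c: "0 \<le> c" and
    bound: "\<And>w b. w \<in> S \<Longrightarrow> h w = ereal b \<Longrightarrow> 1 \<le> norm (w - u0) \<Longrightarrow> a - c * norm (w - u0) \<le> b"
    using convex_lower_bound[OF S h] by blast
  define \<phi> where "\<phi> u = ereal ((norm (v - u))\<^sup>2 / 2) + ereal \<sigma> * h u" for u
  define d where "d = norm (v - u0)"
  \<comment> \<open>At distance \<open>r\<close> from \<open>u0\<close> one has \<open>(r -
    d)\<^sup>2 - 2 * \<sigma> * c * r = d\<^sup>2 + r * (r - 2 * (d + \<sigma> * c))\<close>, which
    is at least \<open>d\<^sup>2\<close> once \<open>r\<close> exceeds this radius. The maximum with
    1 puts \<open>r\<close> in the range of \<open>bound\<close>.\<close>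
  define R where "R = max 1 (2 * (d + \<sigma> * c))"
  define K where "K = S \<inter> cball u0 R"
  have K: "compact K" "K \<noteq> {}" "K \<subseteq> S" "u0 \<in> K"
    using u0 closed_subspace[OF S] by (auto simp: K_def R_def)
  have "lsc_on S \<phi>" unfolding \<phi>_def using lsc_on_prox_objective[OF h(3)] \<sigma> by auto
  then obtain u where u: "u \<in> K" "\<And>w. w \<in> K \<Longrightarrow> \<phi> u \<le> \<phi> w"
    using lsc_on_attains_inf[OF _ K(1-3)] by blast
  have far: "\<phi> u0 \<le> \<phi> w" if w: "w \<in> S" "w \<notin> K" for w
  proof (cases "h w = \<infinity>")
    case True
    then show ?thesis using \<sigma> by (simp add: \<phi>_def)
  next
    case False
    obtain b where b: "h w = ereal b" using proper_on_real[OF h(2) w(1) False] .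
    define r where "r = norm (w - u0)"
    have r: "1 \<le> r" "2 * (d + \<sigma> * c) \<le> r"
      using w by (auto simp: K_def R_def r_def dist_norm norm_minus_commute)
    have 1: "\<sigma> * (a - c * r) \<le> \<sigma> * b"
      using bound[OF w(1) b] r \<sigma> by (auto simp: r_def intro: mult_left_mono)
    have "w - u0 = (v - u0) - (v - w)" by simp
    then have "r \<le> d + norm (v - w)" unfolding r_def d_def by (metis norm_triangle_ineq4)
    moreover have "0 \<le> \<sigma> * c" using c \<sigma> by simp
    ultimately have "(r - d)\<^sup>2 \<le> (norm (v - w))\<^sup>2"
      using r by (intro power_mono) (auto simp: d_def)
    moreover have "0 \<le> r * (r - 2 * (d + \<sigma> * c))" using r by simp
    ultimately have "d\<^sup>2 / 2 + \<sigma> * a \<le> (norm (v - w))\<^sup>2 / 2 + \<sigma> * b"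
      using 1 by (simp add: power2_eq_square algebra_simps)
    then show ?thesis by (simp add: \<phi>_def u0 b d_def)
  qed
  have "\<forall>w\<in>S. \<phi> u \<le> \<phi> w" using u far K(4) order_trans by blast
  then show ?thesis using u(1) K(3) unfolding \<phi>_def by blast
qed

text \<open>The minimiser is compared with a point at fraction \<open>t\<close> of the way to
  \<open>w\<close>. After division by \<open>t\<close> the quadratic remainder is of order
  \<open>t\<close>, and small \<open>t\<close> leaves the first-order condition.\<close>

lemma prox_minimizer_subgrad:
  fixes h :: "'a::euclidean_space \<Rightarrow> ereal"
  assumes S: "subspace S" and h: "ext_convex_on S h" "proper_on S h" and \<sigma>: "0 < \<sigma>"
    and u: "u \<in> S" and min: "\<forall>w\<in>S. ereal ((norm (v - u))\<^sup>2 / 2) + ereal \<sigma> * h u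
            \<le> ereal ((norm (v - w))\<^sup>2 / 2) + ereal \<sigma> * h w"
  shows "subgrad_on S h u ((1 / \<sigma>) *\<^sub>R (v - u))"
proof -
  obtain w0 where w0: "w0 \<in> S" "h w0 \<noteq> \<infinity>" using h(2) by (auto simp: proper_on_def)
  obtain b0 where b0: "h w0 = ereal b0" using proper_on_real[OF h(2) w0] .
  have "h u \<noteq> \<infinity>" using min[rule_format, OF w0(1)] \<sigma> by (auto simp: b0)
  then obtain a where a: "h u = ereal a" using proper_on_real[OF h(2) u] by blast
  have "h u + ereal (((1 / \<sigma>) *\<^sub>R (v - u)) \<bullet> (w - u)) \<le> h w" if w: "w \<in> S" for w
  proof (cases "h w = \<infinity>")
    case False
    obtain b where b: "h w = ereal b" using proper_on_real[OF h(2) w False] .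
    define c where "c = (v - u) \<bullet> (w - u) - \<sigma> * (b - a)"
    define q where "q = (norm (w - u))\<^sup>2 / 2"
    have *: "c \<le> t * q" if t: "0 < t" "t \<le> 1" for t
    proof -
      define w' where "w' = (1 - t) *\<^sub>R u + t *\<^sub>R w"
      have w'S: "w' \<in> S" unfolding w'_def using S u w by (intro subspace_add subspace_scale)
      have "h w' \<le> ereal (1 - t) * h u + ereal t * h w"
        using h(1) u w t unfolding w'_def ext_convex_on_def by simp
      then have hw': "h w' \<le> ereal ((1 - t) * a + t * b)" using a b by simp
      then have "h w' \<noteq> \<infinity>" by auto
      then obtain b' where b': "h w' = ereal b'" using proper_on_real[OF h(2) w'S] by blast
      have le: "\<sigma> * b' \<le> \<sigma> * ((1 - t) * a + t * b)" using hw' b' \<sigma> by simp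
      have eq: "v - w' = (v - u) - t *\<^sub>R (w - u)" by (simp add: w'_def algebra_simps)
      have "(norm (v - w'))\<^sup>2 = (norm (v - u))\<^sup>2 - 2 * t * ((v - u) \<bullet> (w - u)) + t\<^sup>2 * (norm (w - u))\<^sup>2"
        unfolding eq power2_norm_eq_inner
        by (simp add: inner_diff inner_commute algebra_simps power2_eq_square)
      moreover have "(norm (v - u))\<^sup>2 / 2 + \<sigma> * a \<le> (norm (v - w'))\<^sup>2 / 2 + \<sigma> * b'"
        using min[rule_format, OF w'S] a b' by simp
      ultimately have "t * c \<le> t * (t * q)"
        using le by (simp add: c_def q_def algebra_simps power2_eq_square)
      then show ?thesis using t by simp
    qed
    have "c \<le> 0"
    proof (rule ccontr)
      assume c: "\<not> c \<le> 0"
      then have q: "0 < q" using *[of 1] by simp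
      \<comment> \<open>Chosen so that \<open>t * q\<close> is at most \<open>c / 2\<close>, which
        contradicts \<open>*\<close> for positive \<open>c\<close>.\<close>
      define t where "t = min 1 (c / (2 * q))"
      have "0 < t" "t \<le> 1" "t * q \<le> c / 2" using c q by (auto simp: t_def min_def field_simps)
      then show False using *[of t] c by simp
    qed
    then have "(1 / \<sigma>) * ((v - u) \<bullet> (w - u)) \<le> b - a"
      using \<sigma> by (simp add: c_def divide_le_eq mult.commute)
    then show ?thesis using a b by simp
  qed simp
  then show ?thesis using u a by (simp add: subgrad_on_def)
qed

text \<open>The definite description in \<open>prox_on\<close> requires uniqueness. It follows from
  monotonicity: the subgradients at two minimisers differ by a negative multiple of the difference
  of the minimisers.\<close>

lemma prox_on_subgrad:
  fixes h :: "'a::euclidean_space \<Rightarrow> ereal"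
  assumes S: "subspace S" and h: "ext_convex_on S h" "proper_on S h" "lsc_on S h" and \<sigma>: "0 < \<sigma>"
  shows "subgrad_on S h (prox_on S \<sigma> h v) ((1 / \<sigma>) *\<^sub>R (v - prox_on S \<sigma> h v))"
proof -
  let ?P = "\<lambda>u. u \<in> S \<and> (\<forall>w\<in>S. ereal ((norm (v - u))\<^sup>2 / 2) + ereal \<sigma> * h u
            \<le> ereal ((norm (v - w))\<^sup>2 / 2) + ereal \<sigma> * h w)"
  have sg: "subgrad_on S h u ((1 / \<sigma>) *\<^sub>R (v - u))" if "?P u" for u
    using prox_minimizer_subgrad[OF S h(1,2) \<sigma>] that by blast
  obtain u where u: "?P u" using prox_minimizer_exists[OF assms] by blast
  have "u' = u" if "?P u'" for u'
  proof -
    have "0 \<le> ((1 / \<sigma>) *\<^sub>R (v - u') - (1 / \<sigma>) *\<^sub>R (v - u)) \<bullet> (u' - u)"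
      using subgrad_on_monotone[OF sg sg] that u by blast
    also have "\<dots> = - (1 / \<sigma>) * (norm (u' - u))\<^sup>2"
      by (simp add: power2_norm_eq_inner inner_diff algebra_simps)
    finally have "(1 / \<sigma>) * (norm (u' - u))\<^sup>2 \<le> 0" by simp
    then show ?thesis using \<sigma> by (simp add: mult_le_0_iff divide_le_0_iff)
  qed
  then have "?P (prox_on S \<sigma> h v)" unfolding prox_on_def by (rule theI[of ?P, OF u])
  then show ?thesis by (rule sg)
qed

text \<open>Finiteness of the conjugate somewhere amounts to an affine minorant of \<open>f\<close>,
  and the proximal point \<open>u\<close> of the origin provides one with slope
  \<open>- u\<close>.\<close>

lemma conj_on_proper:
  fixes f :: "'a::euclidean_space \<Rightarrow> ereal"
  assumes S: "subspace S" and f: "ext_convex_on S f" "proper_on S f" "lsc_on S f"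
  shows "proper_on S (conj_on S f)"
proof -
  define u where "u = prox_on S 1 f 0"
  have sg: "subgrad_on S f u (- u)"
    using prox_on_subgrad[OF assms, of 1 0] by (simp add: u_def)
  then obtain a where a: "f u = ereal a" and u: "u \<in> S" by (auto simp: subgrad_on_def)
  have "conj_on S f (- u) \<le> ereal (u \<bullet> (- u) - a)"
    unfolding conj_on_def
  proof (rule SUP_least)
    fix w assume w: "w \<in> S"
    then have "ereal a + ereal ((- u) \<bullet> (w - u)) \<le> f w"
      using sg a by (auto simp: subgrad_on_def)
    then show "ereal (w \<bullet> (- u)) - f w \<le> ereal (u \<bullet> (- u) - a)"
      by (cases "f w") (auto simp: inner_diff inner_commute)
  qed
  then have "conj_on S f (- u) \<noteq> \<infinity>" by auto
  moreover have "- u \<in> S" using S u by (rule subspace_neg)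
  moreover have "conj_on S f y \<noteq> -\<infinity>" for y
  proof -
    have "ereal (u \<bullet> y) - f u \<le> conj_on S f y" unfolding conj_on_def using u by (rule SUP_upper)
    then show ?thesis using a by auto
  qed
  ultimately show ?thesis by (auto simp: proper_on_def)
qed

text \<open>A supremum of affine functions; the points with \<open>f u = \<infinity>\<close>
  contribute -\<infinity> and drop out.\<close>

lemma conj_on_convex:
  assumes "proper_on S f"
  shows "ext_convex_on S (conj_on S f)"
  unfolding ext_convex_on_def
proof (intro ballI allI impI)
  fix x y :: 'a and t :: real
  assume t: "0 \<le> t \<and> t \<le> 1"
  show "conj_on S f ((1 - t) *\<^sub>R x + t *\<^sub>R y)
      \<le> ereal (1 - t) * conj_on S f x + ereal t * conj_on S f y"
    unfolding conj_on_def[of S f "(1 - t) *\<^sub>R x + t *\<^sub>R y"]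
  proof (rule SUP_least)
    fix u assume u: "u \<in> S"
    show "ereal (u \<bullet> ((1 - t) *\<^sub>R x + t *\<^sub>R y)) - f u
        \<le> ereal (1 - t) * conj_on S f x + ereal t * conj_on S f y"
    proof (cases "f u = \<infinity>")
      case False
      obtain b where b: "f u = ereal b" using proper_on_real[OF assms u False] .
      have le: "ereal (u \<bullet> z - b) \<le> conj_on S f z" for z
        using SUP_upper[OF u, of "\<lambda>u. ereal (u \<bullet> z) - f u"] b by (simp add: conj_on_def)
      have "ereal (u \<bullet> ((1 - t) *\<^sub>R x + t *\<^sub>R y)) - f u
          = ereal (1 - t) * ereal (u \<bullet> x - b) + ereal t * ereal (u \<bullet> y - b)"
        using b by (simp add: inner_add algebra_simps)
      also have "\<dots> \<le> ereal (1 - t) * conj_on S f x + ereal t * conj_on S f y"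
        using t by (intro add_mono ereal_mult_left_mono le) auto
      finally show ?thesis .
    qed simp
  qed
qed

lemma conj_on_lsc:
  assumes "proper_on S f"
  shows "lsc_on S (conj_on S f)"
  unfolding lsc_on_def
proof (intro ballI allI impI)
  fix x :: 'a and v assume v: "(\<forall>k. v k \<in> S) \<and> v \<longlonglongrightarrow> x"
  show "conj_on S f x \<le> liminf (\<lambda>k. conj_on S f (v k))"
    unfolding conj_on_def[of S f x]
  proof (rule SUP_least)
    fix u assume u: "u \<in> S"
    show "ereal (u \<bullet> x) - f u \<le> liminf (\<lambda>k. conj_on S f (v k))"
    proof (cases "f u = \<infinity>")
      case False
      obtain b where b: "f u = ereal b" using proper_on_real[OF assms u False] .
      have "(\<lambda>k. ereal (u \<bullet> v k - b)) \<longlonglongrightarrow> ereal (u \<bullet> x - b)"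
        using v by (intro tendsto_intros) auto
      then have "ereal (u \<bullet> x) - f u = liminf (\<lambda>k. ereal (u \<bullet> v k - b))"
        by (subst lim_imp_Liminf[where ?f0.0 = "ereal (u \<bullet> x - b)"]) (simp_all add: b)
      also have "\<dots> \<le> liminf (\<lambda>k. conj_on S f (v k))"
        using SUP_upper[OF u, of "\<lambda>u. ereal (u \<bullet> _) - f u"] b
        by (intro Liminf_mono always_eventually allI) (simp add: conj_on_def)
      finally show ?thesis .
    qed simp
  qed
qed

subsection \<open>Nonnegative supermartingales of random iterations\<close>

primrec iterate :: "('s \<Rightarrow> 'i \<Rightarrow> 's) \<Rightarrow> 's \<Rightarrow> (nat \<Rightarrow> 'i) \<Rightarrow> nat \<Rightarrow> 's" where
  "iterate F s js 0 = s"
| "iterate F s js (Suc k) = F (iterate F s js k) (js k)"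

lemma iterate_cong:
  "(\<And>i. i < k \<Longrightarrow> js i = js' i) \<Longrightarrow> iterate F s js k = iterate F s js' k"
  by (induction k) auto

locale random_iteration = prob_space M for M :: "'w measure" +
  fixes J :: "nat \<Rightarrow> 'w \<Rightarrow> 'i::countable" and I :: "'i set" and p :: "'i \<Rightarrow> real"
  assumes fin: "finite I"
    and indep: "indep_vars (\<lambda>_. count_space UNIV) J UNIV"
    and distr: "\<And>k i. i \<in> I \<Longrightarrow> prob {\<omega> \<in> space M. J k \<omega> = i} = p i"
    and p_sum: "sum p I = 1"
begin

abbreviation st :: "('s \<Rightarrow> 'i \<Rightarrow> 's) \<Rightarrow> 's \<Rightarrow> nat \<Rightarrow> 'w \<Rightarrow> 's" where
  "st F s k \<omega> \<equiv> iterate F s (\<lambda>k. J k \<omega>) k"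

lemma J_measurable[measurable]: "J k \<in> measurable M (count_space UNIV)"
  using indep by (auto simp: indep_vars_def)

lemma p_nonneg: "i \<in> I \<Longrightarrow> 0 \<le> p i"
  using distr[of i 0] measure_nonneg by metis

text \<open>The prescribed probabilities on \<open>I\<close> already exhaust the total mass
  1.\<close>

lemma AE_J_mem: "AE \<omega> in M. \<forall>k. J k \<omega> \<in> I"
proof -
  have "AE \<omega> in M. J k \<omega> \<in> I" for k
  proof -
    have "prob {\<omega> \<in> space M. J k \<omega> \<in> I} = prob (\<Union>i\<in>I. {\<omega> \<in> space M. J k \<omega> = i})"
      by (rule arg_cong[where f = prob]) auto
    also have "\<dots> = (\<Sum>i\<in>I. prob {\<omega> \<in> space M. J k \<omega> = i})"
      using fin by (intro finite_measure_finite_Union) (auto simp: disjoint_family_on_def)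
    also have "\<dots> = 1" using distr p_sum by simp
    finally have "prob {\<omega> \<in> space M. J k \<omega> \<in> I} = 1" .
    then show ?thesis using prob_Collect_eq_1[of "\<lambda>\<omega>. J k \<omega> \<in> I"] by simp
  qed
  then show ?thesis by (simp add: AE_all_countable)
qed

text \<open>For arbitrary \<open>F\<close> the state depends on finitely many countably valued
  draws, so it is measurable even for the discrete sigma-algebra. Hence measurability of proximal
  maps never has to be checked.\<close>

lemma iterate_measurable_PiM:
  fixes F :: "'s \<Rightarrow> 'i \<Rightarrow> 's"
  shows "k \<le> m \<Longrightarrow> (\<lambda>js. iterate F s js k)
    \<in> measurable (PiM {..<m} (\<lambda>_. count_space UNIV)) (count_space UNIV)"
proof (induction k)
  case (Suc k)
  have "(\<lambda>js. (\<lambda>i js. F (iterate F s js k) i) (js k) js)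
      \<in> measurable (PiM {..<m} (\<lambda>_. count_space UNIV)) (count_space UNIV)"
  proof (rule measurable_compose_countable[where f = "\<lambda>i js. F (iterate F s js k) i" and g = "\<lambda>js. js k"])
    show "(\<lambda>js. js k :: 'i) \<in> measurable (PiM {..<m} (\<lambda>_. count_space UNIV)) (count_space UNIV)"
      using Suc.prems by (intro measurable_component_singleton) auto
    show "(\<lambda>js. F (iterate F s js k) i)
        \<in> measurable (PiM {..<m} (\<lambda>_. count_space UNIV)) (count_space UNIV)" for i
      using Suc by (intro measurable_compose[OF Suc.IH]) auto
  qed
  then show ?case by simp
qed simp

lemma st_eq_restrict: "st F s k \<omega> = iterate F s (restrict (\<lambda>i. J i \<omega>) {..<k}) k"
  by (rule iterate_cong) auto

text \<open>The state at time \<open>k\<close> uses only the draws with index below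
  \<open>k\<close>, a block disjoint from \<open>{k}\<close>.\<close>

lemma indep_st_J:
  fixes h :: "'s \<Rightarrow> 'b::topological_space" and e :: "'i \<Rightarrow> 'b"
  shows "indep_var borel (\<lambda>\<omega>. h (st F s k \<omega>)) borel (\<lambda>\<omega>. e (J k \<omega>))"
proof -
  have "indep_var (PiM {..<k} (\<lambda>_. count_space UNIV)) (\<lambda>\<omega>. restrict (\<lambda>i. J i \<omega>) {..<k})
      (PiM {k} (\<lambda>_. count_space UNIV)) (\<lambda>\<omega>. restrict (\<lambda>i. J i \<omega>) {k})"
    by (rule indep_var_restrict[OF indep]) auto
  moreover have "(\<lambda>js. h (iterate F s js k)) \<in> borel_measurable (PiM {..<k} (\<lambda>_. count_space UNIV))"
    by (rule measurable_compose[OF iterate_measurable_PiM]) auto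
  moreover have "(\<lambda>js. e (js k)) \<in> borel_measurable (PiM {k} (\<lambda>_. count_space UNIV))"
    by (rule measurable_compose[OF measurable_component_singleton]) auto
  ultimately have "indep_var borel ((\<lambda>js. h (iterate F s js k)) \<circ> (\<lambda>\<omega>. restrict (\<lambda>i. J i \<omega>) {..<k}))
      borel ((\<lambda>js. e (js k)) \<circ> (\<lambda>\<omega>. restrict (\<lambda>i. J i \<omega>) {k}))"
    by (rule indep_var_compose)
  then show ?thesis by (simp add: comp_def st_eq_restrict[symmetric])
qed

lemma st_measurable[measurable]: "st F s k \<in> measurable M (count_space UNIV)"
proof -
  have "(\<lambda>\<omega>. iterate F s (restrict (\<lambda>i. J i \<omega>) {..<k}) k) \<in> measurable M (count_space UNIV)"
    by (rule measurable_compose[OF measurable_restrict iterate_measurable_PiM]) auto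
  then show ?thesis by (simp add: st_eq_restrict[symmetric])
qed

lemma fun_st_measurable[measurable]: "(\<lambda>\<omega>. h (st F s k \<omega>)) \<in> borel_measurable M"
  by (rule measurable_compose[OF st_measurable]) simp

text \<open>This replaces conditional expectation given the past: split according to the value of
  the fresh draw, then use its independence of the current state to replace the indicator by
  \<open>p i\<close>.\<close>

lemma nn_integral_st_Suc:
  fixes h :: "'s \<Rightarrow> ennreal"
  shows "(\<integral>\<^sup>+\<omega>. h (st F s (Suc k) \<omega>) \<partial>M)
    = (\<integral>\<^sup>+\<omega>. (\<Sum>i\<in>I. ennreal (p i) * h (F (st F s k \<omega>) i)) \<partial>M)"
proof -
  have prod: "(\<integral>\<^sup>+\<omega>. h (F (st F s k \<omega>) i) * indicator {i} (J k \<omega>) \<partial>M)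
      = (\<integral>\<^sup>+\<omega>. ennreal (p i) * h (F (st F s k \<omega>) i) \<partial>M)" if i: "i \<in> I" for i
  proof -
    define Y :: "bool \<Rightarrow> 'w \<Rightarrow> ennreal" where
      "Y = case_bool (\<lambda>\<omega>. h (F (st F s k \<omega>) i)) (\<lambda>\<omega>. indicator {i} (J k \<omega>))"
    have "indep_var borel (\<lambda>\<omega>. h (F (st F s k \<omega>) i)) borel (\<lambda>\<omega>. indicator {i} (J k \<omega>) :: ennreal)"
      by (rule indep_st_J)
    moreover have "case_bool borel borel = (\<lambda>_. borel :: ennreal measure)"
      by (auto simp: fun_eq_iff split: bool.split)
    ultimately have "indep_vars (\<lambda>_. borel) Y UNIV" by (simp add: indep_var_def Y_def)
    then have "(\<integral>\<^sup>+\<omega>. (\<Prod>b\<in>UNIV. Y b \<omega>) \<partial>M) = (\<Prod>b\<in>UNIV. \<integral>\<^sup>+\<omega>. Y b \<omega> \<partial>M)"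
      by (intro indep_vars_nn_integral) auto
    then have "(\<integral>\<^sup>+\<omega>. h (F (st F s k \<omega>) i) * indicator {i} (J k \<omega>) \<partial>M)
        = (\<integral>\<^sup>+\<omega>. h (F (st F s k \<omega>) i) \<partial>M) * (\<integral>\<^sup>+\<omega>. indicator {i} (J k \<omega>) \<partial>M)"
      by (simp add: UNIV_bool Y_def mult.commute)
    also have "(\<integral>\<^sup>+\<omega>. indicator {i} (J k \<omega>) \<partial>M)
        = (\<integral>\<^sup>+\<omega>. indicator {\<omega> \<in> space M. J k \<omega> = i} \<omega> \<partial>M)"
      by (intro nn_integral_cong) (auto simp: indicator_def)
    also have "\<dots> = ennreal (p i)" using distr[OF i, of k] by (simp add: emeasure_eq_measure)
    finally show ?thesis by (simp add: nn_integral_cmult mult.commute)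
  qed
  have "(\<integral>\<^sup>+\<omega>. h (st F s (Suc k) \<omega>) \<partial>M)
      = (\<integral>\<^sup>+\<omega>. (\<Sum>i\<in>I. h (F (st F s k \<omega>) i) * indicator {i} (J k \<omega>)) \<partial>M)"
  proof (rule nn_integral_cong_AE)
    show "AE \<omega> in M. h (st F s (Suc k) \<omega>) = (\<Sum>i\<in>I. h (F (st F s k \<omega>) i) * indicator {i} (J k \<omega>))"
      using AE_J_mem
    proof eventually_elim
      case (elim \<omega>)
      have "(\<Sum>i\<in>I. h (F (st F s k \<omega>) i) * indicator {i} (J k \<omega>))
          = (\<Sum>i\<in>I. if i = J k \<omega> then h (F (st F s k \<omega>) i) else 0)"
        by (intro sum.cong) (auto simp: indicator_def)
      then show ?case using elim fin by (simp add: sum.delta)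
    qed
  qed
  also have "\<dots> = (\<Sum>i\<in>I. \<integral>\<^sup>+\<omega>. h (F (st F s k \<omega>) i) * indicator {i} (J k \<omega>) \<partial>M)"
    by (intro nn_integral_sum) auto
  also have "\<dots> = (\<Sum>i\<in>I. \<integral>\<^sup>+\<omega>. ennreal (p i) * h (F (st F s k \<omega>) i) \<partial>M)"
    using prod by (intro sum.cong) auto
  also have "\<dots> = (\<integral>\<^sup>+\<omega>. (\<Sum>i\<in>I. ennreal (p i) * h (F (st F s k \<omega>) i)) \<partial>M)"
    by (intro nn_integral_sum[symmetric]) auto
  finally show ?thesis .
qed

lemma AE_st_invariant:
  assumes "s \<in> R" "\<forall>x\<in>R. \<forall>i\<in>I. F x i \<in> R"
  shows "AE \<omega> in M. \<forall>k. st F s k \<omega> \<in> R"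
  using AE_J_mem
proof eventually_elim
  case (elim \<omega>)
  have "st F s k \<omega> \<in> R" for k by (induction k) (use assms elim in auto)
  then show ?case ..
qed

text \<open>The one-step drift is integrated and telescoped. Passing through almost sure membership
  in \<open>R\<close> allows sign and drift conditions to be imposed on the invariant set
  only.\<close>

lemma drift_bound:
  fixes W D :: "'s \<Rightarrow> real"
  assumes s: "s \<in> R" and inv: "\<forall>x\<in>R. \<forall>i\<in>I. F x i \<in> R"
    and W: "\<forall>x\<in>R. 0 \<le> W x" and D: "\<forall>x\<in>R. 0 \<le> D x"
    and drift: "\<forall>x\<in>R. (\<Sum>i\<in>I. p i * W (F x i)) + D x \<le> W x"
  shows "(\<integral>\<^sup>+\<omega>. ennreal (W (st F s m \<omega>)) \<partial>M)
    + (\<Sum>k<m. \<integral>\<^sup>+\<omega>. ennreal (D (st F s k \<omega>)) \<partial>M) \<le> ennreal (W s)"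
proof (induction m)
  case 0
  show ?case by (simp add: emeasure_space_1)
next
  case (Suc m)
  have "(\<integral>\<^sup>+\<omega>. ennreal (W (st F s (Suc m) \<omega>)) \<partial>M) + (\<integral>\<^sup>+\<omega>. ennreal (D (st F s m \<omega>)) \<partial>M)
      = (\<integral>\<^sup>+\<omega>. (\<Sum>i\<in>I. ennreal (p i) * ennreal (W (F (st F s m \<omega>) i)))
          + ennreal (D (st F s m \<omega>)) \<partial>M)"
    by (subst nn_integral_st_Suc, subst nn_integral_add)
      (auto intro!: borel_measurable_sum borel_measurable_times_ennreal
        fun_st_measurable[where h = "\<lambda>x. ennreal (W (F x _))"])
  also have "\<dots> \<le> (\<integral>\<^sup>+\<omega>. ennreal (W (st F s m \<omega>)) \<partial>M)"
  proof (rule nn_integral_mono_AE)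
    show "AE \<omega> in M. (\<Sum>i\<in>I. ennreal (p i) * ennreal (W (F (st F s m \<omega>) i)))
          + ennreal (D (st F s m \<omega>)) \<le> ennreal (W (st F s m \<omega>))"
      using AE_st_invariant[where R = R and F = F, OF s inv]
    proof eventually_elim
      case (elim \<omega>)
      let ?x = "st F s m \<omega>"
      have "(\<Sum>i\<in>I. ennreal (p i) * ennreal (W (F ?x i))) = ennreal (\<Sum>i\<in>I. p i * W (F ?x i))"
        using elim inv W p_nonneg by (subst sum_ennreal[symmetric]) (auto simp: ennreal_mult)
      moreover have "0 \<le> (\<Sum>i\<in>I. p i * W (F ?x i))"
        using elim inv W p_nonneg by (intro sum_nonneg mult_nonneg_nonneg) auto
      ultimately show ?case
        using elim D drift[rule_format, of ?x]
        by (simp add: ennreal_plus[symmetric] ennreal_leI del: ennreal_plus)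
    qed
  qed
  finally have le: "(\<integral>\<^sup>+\<omega>. ennreal (W (st F s (Suc m) \<omega>)) \<partial>M) + (\<integral>\<^sup>+\<omega>. ennreal (D (st F s m \<omega>)) \<partial>M)
      \<le> (\<integral>\<^sup>+\<omega>. ennreal (W (st F s m \<omega>)) \<partial>M)" .
  have "(\<integral>\<^sup>+\<omega>. ennreal (W (st F s (Suc m) \<omega>)) \<partial>M)
        + (\<Sum>k<Suc m. \<integral>\<^sup>+\<omega>. ennreal (D (st F s k \<omega>)) \<partial>M)
      = ((\<integral>\<^sup>+\<omega>. ennreal (W (st F s (Suc m) \<omega>)) \<partial>M) + (\<integral>\<^sup>+\<omega>. ennreal (D (st F s m \<omega>)) \<partial>M))
        + (\<Sum>k<m. \<integral>\<^sup>+\<omega>. ennreal (D (st F s k \<omega>)) \<partial>M)"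
    by (simp only: sum.lessThan_Suc ac_simps)
  also have "\<dots> \<le> (\<integral>\<^sup>+\<omega>. ennreal (W (st F s m \<omega>)) \<partial>M)
        + (\<Sum>k<m. \<integral>\<^sup>+\<omega>. ennreal (D (st F s k \<omega>)) \<partial>M)"
    by (rule add_right_mono[OF le])
  also have "\<dots> \<le> ennreal (W s)" by (rule Suc.IH)
  finally show ?case .
qed

text \<open>The series of the \<open>D\<close> terms has expectation at most \<open>W s\<close>, so
  almost surely it is finite and its terms vanish in the limit.\<close>

lemma AE_D_tendsto_0:
  fixes W D :: "'s \<Rightarrow> real"
  assumes s: "s \<in> R" and inv: "\<forall>x\<in>R. \<forall>i\<in>I. F x i \<in> R"
    and W: "\<forall>x\<in>R. 0 \<le> W x" and D: "\<forall>x\<in>R. 0 \<le> D x"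
    and drift: "\<forall>x\<in>R. (\<Sum>i\<in>I. p i * W (F x i)) + D x \<le> W x"
  shows "AE \<omega> in M. (\<lambda>k. D (st F s k \<omega>)) \<longlonglongrightarrow> 0"
proof -
  have "(\<integral>\<^sup>+\<omega>. (\<Sum>k. ennreal (D (st F s k \<omega>))) \<partial>M) = (\<Sum>k. \<integral>\<^sup>+\<omega>. ennreal (D (st F s k \<omega>)) \<partial>M)"
    by (rule nn_integral_suminf) auto
  also have "\<dots> \<le> ennreal (W s)"
  proof (rule suminf_le_const)
    fix m
    show "(\<Sum>k<m. \<integral>\<^sup>+\<omega>. ennreal (D (st F s k \<omega>)) \<partial>M) \<le> ennreal (W s)"
      using drift_bound[of s R F W D m, OF assms]
      by (meson add_increasing order_refl order_trans zero_le)
  qed simp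
  finally have "(\<integral>\<^sup>+\<omega>. (\<Sum>k. ennreal (D (st F s k \<omega>))) \<partial>M) \<noteq> \<infinity>"
    by (auto simp: top_unique)
  then have "AE \<omega> in M. (\<Sum>k. ennreal (D (st F s k \<omega>))) \<noteq> \<infinity>"
    by (intro nn_integral_PInf_AE) auto
  with AE_st_invariant[where R = R and F = F, OF s inv] show ?thesis
  proof eventually_elim
    case (elim \<omega>)
    then have "summable (\<lambda>k. D (st F s k \<omega>))"
      using D by (intro summable_suminf_not_top) auto
    then show ?case by (rule summable_LIMSEQ_zero)
  qed
qed

text \<open>The flag records whether the process is on its way up from a value below \<open>a\<close>;
  the counter counts the completed passages from below \<open>a\<close> to above \<open>b\<close>.\<close>
definition upcross :: "('s \<Rightarrow> real) \<Rightarrow> real \<Rightarrow> real \<Rightarrow> ('s \<Rightarrow> 'i \<Rightarrow> 's)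
    \<Rightarrow> 's \<times> bool \<times> nat \<Rightarrow> 'i \<Rightarrow> 's \<times> bool \<times> nat" where
  "upcross W a b F = (\<lambda>(x, up, c) i.
     let x' = F x i in
       if up then (if b \<le> W x' then (x', False, Suc c) else (x', True, c))
       else (x', W x' \<le> a, c))"

lemma fst_st_upcross: "fst (st (upcross W a b F) (s, u) k \<omega>) = st F s k \<omega>"
  by (induction k) (auto simp: upcross_def Let_def split: prod.splits)

text \<open>Doob's upcrossing inequality, run as an iteration on the state enlarged by flag and
  counter, so that \<open>drift_bound\<close> applies again. The expected counter is at most
  \<open>a / (b - a)\<close> at all times, and monotone convergence passes this to the total
  count.\<close>

lemma AE_bounded_upcrossings:
  fixes W :: "'s \<Rightarrow> real"
  assumes s: "s \<in> R" and inv: "\<forall>x\<in>R. \<forall>i\<in>I. F x i \<in> R"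
    and W: "\<forall>x\<in>R. 0 \<le> W x"
    and drift: "\<forall>x\<in>R. (\<Sum>i\<in>I. p i * W (F x i)) \<le> W x"
    and ab: "0 \<le> a" "a < b"
  shows "AE \<omega> in M. \<exists>N. \<forall>k. snd (snd (st (upcross W a b F) (s, False, 0) k \<omega>)) \<le> N"
proof -
  let ?G = "upcross W a b F" and ?s = "(s, False, 0::nat)"
  \<comment> \<open>A change of the flag never increases this potential, so it is again a supermartingale;
    its initial value \<open>a\<close> bounds the expected value of \<open>(b - a) * c\<close>.\<close>
  define B where "B = (\<lambda>(x::'s, up, c::nat). (b - a) * c + (if up then W x else a))"
  define R' where "R' = {t::'s \<times> bool \<times> nat. fst t \<in> R}"
  have B_nonneg: "\<forall>t\<in>R'. 0 \<le> B t"
    using ab W by (auto simp: B_def R'_def split: prod.splits)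
  \<comment> \<open>Raising the flag replaces \<open>a\<close> by a value at most \<open>a\<close>.
    Completing a passage adds \<open>b - a\<close> to the counter part and leaves \<open>a\<close>,
    a total of \<open>b\<close>, in place of a value at least \<open>b\<close>.\<close>
  have step: "B (?G (x, up, c) i) \<le> (b - a) * c + (if up then W (F x i) else a)" for x up c i
    by (auto simp: B_def upcross_def Let_def algebra_simps)
  have drift': "\<forall>t\<in>R'. (\<Sum>i\<in>I. p i * B (?G t i)) + 0 \<le> B t"
  proof
    fix t assume t: "t \<in> R'"
    obtain x up c where tx: "t = (x, up, c)" by (cases t)
    have "(\<Sum>i\<in>I. p i * B (?G t i)) \<le> (\<Sum>i\<in>I. p i * ((b - a) * c + (if up then W (F x i) else a)))"
      unfolding tx using p_nonneg step by (intro sum_mono mult_left_mono)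
    also have "\<dots> = (b - a) * c + (if up then (\<Sum>i\<in>I. p i * W (F x i)) else a)"
      by (simp add: distrib_left sum.distrib sum_distrib_right[symmetric] p_sum)
    also have "\<dots> \<le> B t" using drift[rule_format, of x] t by (simp add: tx B_def R'_def)
    finally show "(\<Sum>i\<in>I. p i * B (?G t i)) + 0 \<le> B t" by simp
  qed
  have inv': "\<forall>t\<in>R'. \<forall>i\<in>I. ?G t i \<in> R'"
    using inv by (auto simp: R'_def upcross_def Let_def split: prod.splits)
  have s': "?s \<in> R'" using s by (simp add: R'_def)
  define C where "C k \<omega> = ennreal (real (snd (snd (st ?G ?s k \<omega>))))" for k \<omega>
  have C_meas[measurable]: "C k \<in> borel_measurable M" for k
    unfolding C_def by (rule fun_st_measurable[where h = "\<lambda>t. ennreal (real (snd (snd t)))"])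
  have C_bound: "(\<integral>\<^sup>+\<omega>. C k \<omega> \<partial>M) \<le> ennreal (a / (b - a))" for k
  proof -
    have "ennreal (b - a) * (\<integral>\<^sup>+\<omega>. C k \<omega> \<partial>M) = (\<integral>\<^sup>+\<omega>. ennreal (b - a) * C k \<omega> \<partial>M)"
      by (simp add: nn_integral_cmult)
    also have "\<dots> \<le> (\<integral>\<^sup>+\<omega>. ennreal (B (st ?G ?s k \<omega>)) \<partial>M)"
    proof (rule nn_integral_mono_AE)
      show "AE \<omega> in M. ennreal (b - a) * C k \<omega> \<le> ennreal (B (st ?G ?s k \<omega>))"
        using AE_st_invariant[where R = R' and F = ?G, OF s' inv']
      proof eventually_elim
        case (elim \<omega>)
        obtain x up c where tx: "st ?G ?s k \<omega> = (x, up, c)" by (cases "st ?G ?s k \<omega>")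
        have "x \<in> R" using elim tx by (metis (mono_tags, lifting) R'_def fst_conv mem_Collect_eq)
        then show ?case
          using ab W by (auto simp: C_def tx B_def ennreal_mult[symmetric] intro!: ennreal_leI)
      qed
    qed
    also have "\<dots> \<le> ennreal (B ?s)"
      using drift_bound[of ?s R' ?G B "\<lambda>_. 0" k, OF s' inv' B_nonneg _ drift'] by simp
    also have "B ?s = (b - a) * (a / (b - a))" using ab by (simp add: B_def)
    also have "ennreal \<dots> = ennreal (b - a) * ennreal (a / (b - a))"
      using ab by (intro ennreal_mult) auto
    finally show ?thesis using ab by (simp add: ennreal_mult_le_mult_iff)
  qed
  have inc: "incseq (\<lambda>k. C k \<omega>)" for \<omega>
    by (rule incseq_SucI)
      (auto simp: C_def upcross_def Let_def intro!: ennreal_leI split: prod.splits)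
  have "(\<integral>\<^sup>+\<omega>. (SUP k. C k \<omega>) \<partial>M) = (SUP k. \<integral>\<^sup>+\<omega>. C k \<omega> \<partial>M)"
    using inc by (intro nn_integral_monotone_convergence_SUP) (auto simp: incseq_def le_fun_def)
  also have "\<dots> \<le> ennreal (a / (b - a))" using C_bound by (intro SUP_least)
  finally have "(\<integral>\<^sup>+\<omega>. (SUP k. C k \<omega>) \<partial>M) \<noteq> \<infinity>" by (auto simp: top_unique)
  then have "AE \<omega> in M. (SUP k. C k \<omega>) \<noteq> \<infinity>" by (intro nn_integral_PInf_AE) auto
  then show ?thesis
  proof eventually_elim
    case (elim \<omega>)
    then obtain N where N: "(SUP k. C k \<omega>) < ennreal (real N)"
      by (metis ennreal_Ex_less_of_nat ennreal_of_nat_eq_real_of_nat infinity_ennreal_def less_top)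
    have "snd (snd (st ?G ?s k \<omega>)) \<le> N" for k
    proof -
      have "C k \<omega> < ennreal (real N)" using N by (meson SUP_lessD UNIV_I)
      then show ?thesis by (simp add: C_def ennreal_less_iff)
    qed
    then show ?case by blast
  qed
qed

text \<open>Recurring low values raise the flag after any time, and recurring high values turn a
  raised flag into another completed passage. This is the pathwise counterpart of the almost sure
  bound on the counter.\<close>

lemma upcrossings_unbounded:
  assumes low: "\<exists>\<^sub>F k in sequentially. W (st F s k \<omega>) \<le> a"
    and high: "\<exists>\<^sub>F k in sequentially. b \<le> W (st F s k \<omega>)"
  shows "\<not> (\<forall>k. snd (snd (st (upcross W a b F) (s, False, 0) k \<omega>)) \<le> N)"
proof -
  define T where "T k = st (upcross W a b F) (s, False, 0) k \<omega>" for k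
  define up where "up k = fst (snd (T k))" for k
  define c where "c k = snd (snd (T k))" for k
  have T: "T k = (st F s k \<omega>, up k, c k)" for k
    using fst_st_upcross[of W a b F s "(False, 0)" \<omega> k] by (simp add: T_def up_def c_def prod_eq_iff)
  have T_Suc: "T (Suc k) = (let x' = st F s (Suc k) \<omega> in
       if up k then (if b \<le> W x' then (x', False, Suc (c k)) else (x', True, c k))
       else (x', W x' \<le> a, c k))" for k
    using T[of k] by (simp add: T_def upcross_def Let_def)
  have up_Suc: "up (Suc k) \<longleftrightarrow> (if up k then \<not> b \<le> W (st F s (Suc k) \<omega>) else W (st F s (Suc k) \<omega>) \<le> a)"
    and c_Suc: "c (Suc k) = (if up k \<and> b \<le> W (st F s (Suc k) \<omega>) then Suc (c k) else c k)" for k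
    using T_Suc[of k] unfolding T[of "Suc k"] by (auto simp: Let_def split: if_splits)
  have c_mono: "c k \<le> c (k + d)" for k d by (induction d) (auto simp: c_Suc)
  have ex_up: "\<exists>d. up (k + d)" for k
  proof (rule ccontr)
    assume no: "\<nexists>d. up (k + d)"
    \<comment> \<open>The flag at time \<open>m\<close> is set from the value at \<open>m\<close>
      when the flag at \<open>m - 1\<close> is down, so \<open>m\<close> must be strictly beyond
      \<open>k\<close>.\<close>
    obtain m where m: "k < m" "W (st F s m \<omega>) \<le> a"
      using low unfolding frequently_sequentially by (meson Suc_le_lessD)
    then have "up m" using up_Suc[of "m - 1"] no[simplified, rule_format, of "m - 1 - k"] by simp
    then show False using no m(1) by (metis less_imp_add_positive)
  qed
  have ex_Suc: "\<exists>d. c k < c (k + d)" if "up k" for k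
  proof (rule ccontr)
    assume "\<nexists>d. c k < c (k + d)"
    then have const: "c (k + d) = c k" for d by (metis c_mono le_neq_implies_less)
    have stay: "up (k + d)" for d
    proof (induction d)
      case (Suc d)
      then show ?case using c_Suc[of "k + d"] up_Suc[of "k + d"] const[of d] const[of "Suc d"]
        by (auto split: if_splits)
    qed (use that in simp)
    obtain m where m: "k < m" "b \<le> W (st F s m \<omega>)"
      using high unfolding frequently_sequentially by (meson Suc_le_lessD)
    then obtain d where d: "m = Suc (k + d)" using less_imp_Suc_add by blast
    then have "c (k + Suc d) = Suc (c (k + d))" using c_Suc[of "k + d"] stay[of d] m by simp
    then show False using const[of d] const[of "Suc d"] by simp
  qed
  have "\<exists>k. n \<le> c k" for n
  proof (induction n)
    case (Suc n)
    then obtain k where k: "n \<le> c k" by blast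
    obtain d where d: "up (k + d)" using ex_up by blast
    obtain e where e: "c (k + d) < c (k + d + e)" using ex_Suc[OF d] by blast
    have "Suc n \<le> c (k + d + e)" using k e c_mono[of k d] by simp
    then show ?case ..
  qed simp
  then obtain k where "Suc N \<le> c k" by blast
  then show ?thesis unfolding c_def T_def using Suc_n_not_le_n order_trans by blast
qed

end

text \<open>Distinct lower and upper limits would leave room for two rationals between them, both
  crossed infinitely often. The hypothesis \<open>low\<close> excludes divergence to
  infinity.\<close>

lemma convergent_if_no_oscillation:
  fixes X :: "nat \<Rightarrow> real"
  assumes nonneg: "\<And>k. 0 \<le> X k" and low: "\<exists>\<^sub>F k in sequentially. X k < c"
    and osc: "\<And>a b. a \<in> \<rat> \<Longrightarrow> b \<in> \<rat> \<Longrightarrow> 0 \<le> a \<Longrightarrow> a < b \<Longrightarrow>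
      \<not> ((\<exists>\<^sub>F k in sequentially. X k \<le> a) \<and> (\<exists>\<^sub>F k in sequentially. b \<le> X k))"
  shows "convergent X"
proof -
  let ?Y = "\<lambda>k. ereal (X k)"
  have "liminf ?Y = limsup ?Y"
  proof (rule ccontr)
    assume "liminf ?Y \<noteq> limsup ?Y"
    then have "liminf ?Y < limsup ?Y"
      using Liminf_le_Limsup[of sequentially ?Y] by simp
    then obtain b where b: "liminf ?Y < ereal (real_of_rat b)" "ereal (real_of_rat b) < limsup ?Y"
      using ereal_dense3 by blast
    obtain a where a: "liminf ?Y < ereal (real_of_rat a)" "ereal (real_of_rat a) < ereal (real_of_rat b)"
      using ereal_dense3[OF b(1)] by blast
    have freq_a: "\<exists>\<^sub>F k in sequentially. X k \<le> real_of_rat a"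
    proof (rule ccontr)
      assume "\<not> ?thesis"
      then have "\<forall>\<^sub>F k in sequentially. ereal (real_of_rat a) \<le> ?Y k"
        by (auto simp: not_frequently elim: eventually_mono)
      then have "ereal (real_of_rat a) \<le> liminf ?Y" by (rule Liminf_bounded)
      then show False using a(1) by simp
    qed
    have freq_b: "\<exists>\<^sub>F k in sequentially. real_of_rat b \<le> X k"
    proof (rule ccontr)
      assume "\<not> ?thesis"
      then have "\<forall>\<^sub>F k in sequentially. ?Y k \<le> ereal (real_of_rat b)"
        by (auto simp: not_frequently elim: eventually_mono)
      then have "limsup ?Y \<le> ereal (real_of_rat b)" by (rule Limsup_bounded)
      then show False using b(2) by simp
    qed
    have "0 \<le> real_of_rat a"
      using frequently_ex[OF freq_a] nonneg order_trans by blast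
    then show False using osc[of "real_of_rat a" "real_of_rat b"] freq_a freq_b a(2) by auto
  qed
  then have lim: "?Y \<longlonglongrightarrow> liminf ?Y"
    by (intro tendsto_iff_Liminf_eq_Limsup[THEN iffD2]) auto
  have "liminf ?Y \<noteq> \<infinity>"
  proof
    assume "liminf ?Y = \<infinity>"
    then have "\<forall>\<^sub>F k in sequentially. ereal c < ?Y k" by (intro less_LiminfD) simp
    then have "\<forall>\<^sub>F k in sequentially. \<not> X k < c" by (auto elim: eventually_mono)
    then show False using low by (simp add: frequently_def)
  qed
  moreover have "0 \<le> liminf ?Y" using nonneg by (intro Liminf_bounded always_eventually) simp
  ultimately obtain l where "liminf ?Y = ereal l" by (cases "liminf ?Y") auto
  then have "X \<longlonglongrightarrow> l" using lim by simp
  then show ?thesis by (auto simp: convergent_def)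
qed

text \<open>Fatou's lemma makes the lower limit finite almost surely. Upcrossing bounds for the
  countably many rational pairs hold simultaneously off one null set and exclude
  oscillation.\<close>

lemma (in random_iteration) AE_W_convergent:
  fixes W :: "'s \<Rightarrow> real"
  assumes s: "s \<in> R" and inv: "\<forall>x\<in>R. \<forall>i\<in>I. F x i \<in> R"
    and W: "\<forall>x\<in>R. 0 \<le> W x"
    and drift: "\<forall>x\<in>R. (\<Sum>i\<in>I. p i * W (F x i)) \<le> W x"
  shows "AE \<omega> in M. convergent (\<lambda>k. W (st F s k \<omega>))"
proof -
  have "(\<integral>\<^sup>+\<omega>. liminf (\<lambda>k. ennreal (W (st F s k \<omega>))) \<partial>M)
      \<le> liminf (\<lambda>k. \<integral>\<^sup>+\<omega>. ennreal (W (st F s k \<omega>)) \<partial>M)"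
    by (intro nn_integral_liminf) auto
  also have "\<dots> \<le> ennreal (W s)"
    using drift_bound[of s R F W "\<lambda>_. 0", OF s inv W] drift
    by (intro Liminf_le always_eventually allI) simp_all
  finally have "(\<integral>\<^sup>+\<omega>. liminf (\<lambda>k. ennreal (W (st F s k \<omega>))) \<partial>M) \<noteq> \<infinity>"
    by (auto simp: top_unique)
  then have fin_liminf: "AE \<omega> in M. liminf (\<lambda>k. ennreal (W (st F s k \<omega>))) \<noteq> \<infinity>"
    by (intro nn_integral_PInf_AE) auto
  have "countable {(a, b). a \<in> \<rat> \<and> b \<in> \<rat> \<and> 0 \<le> a \<and> (a::real) < b}"
    by (rule countable_subset[of _ "\<rat> \<times> \<rat>"]) (auto intro: countable_rat)
  then have "AE \<omega> in M. \<forall>ab\<in>{(a, b). a \<in> \<rat> \<and> b \<in> \<rat> \<and> 0 \<le> a \<and> (a::real) < b}.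
      \<exists>N. \<forall>k. snd (snd (st (upcross W (fst ab) (snd ab) F) (s, False, 0) k \<omega>)) \<le> N"
    by (subst AE_ball_countable)
      (auto intro!: AE_bounded_upcrossings[where R = R, OF s inv W drift])
  then show ?thesis
    using fin_liminf AE_st_invariant[where R = R and F = F, OF s inv]
  proof eventually_elim
    case (elim \<omega>)
    obtain N where N: "liminf (\<lambda>k. ennreal (W (st F s k \<omega>))) < ennreal (real N)"
      using elim(2)
      by (metis ennreal_Ex_less_of_nat ennreal_of_nat_eq_real_of_nat infinity_ennreal_def less_top)
    show ?case
    proof (rule convergent_if_no_oscillation)
      show "0 \<le> W (st F s k \<omega>)" for k using elim(3) W by auto
      show "\<exists>\<^sub>F k in sequentially. W (st F s k \<omega>) < real N"
      proof (rule ccontr)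
        assume "\<not> ?thesis"
        then have "\<forall>\<^sub>F k in sequentially. ennreal (real N) \<le> ennreal (W (st F s k \<omega>))"
          by (auto simp: not_frequently elim!: eventually_mono intro!: ennreal_leI)
        then have "ennreal (real N) \<le> liminf (\<lambda>k. ennreal (W (st F s k \<omega>)))"
          by (rule Liminf_bounded)
        then show False using N by simp
      qed
      show "\<not> ((\<exists>\<^sub>F k in sequentially. W (st F s k \<omega>) \<le> a) \<and> (\<exists>\<^sub>F k in sequentially. b \<le> W (st F s k \<omega>)))"
        if "a \<in> \<rat>" "b \<in> \<rat>" "0 \<le> a" "a < b" for a b
        using elim(1)[rule_format, of "(a, b)"] upcrossings_unbounded[of W F s \<omega> a b] that by auto
    qed
  qed
qed

subsection \<open>Norm inequalities and subsequences\<close>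

lemma young_inner:
  fixes a b :: "'a::real_inner"
  assumes "0 < c"
  shows "a \<bullet> b \<le> c / 2 * (norm a)\<^sup>2 + 1 / (2 * c) * (norm b)\<^sup>2"
proof -
  have "0 \<le> (norm (c *\<^sub>R a - b))\<^sup>2" by simp
  also have "\<dots> = c\<^sup>2 * (norm a)\<^sup>2 - 2 * c * (a \<bullet> b) + (norm b)\<^sup>2"
    unfolding power2_norm_eq_inner
    by (simp add: inner_diff inner_commute algebra_simps power2_eq_square)
  finally have "2 * c * (a \<bullet> b) \<le> c\<^sup>2 * (norm a)\<^sup>2 + (norm b)\<^sup>2" by simp
  then have "(a \<bullet> b) \<le> (c\<^sup>2 * (norm a)\<^sup>2 + (norm b)\<^sup>2) / (2 * c)"
    using assms by (simp add: le_divide_eq algebra_simps)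
  also have "\<dots> = c / 2 * (norm a)\<^sup>2 + 1 / (2 * c) * (norm b)\<^sup>2"
    using assms by (simp add: field_simps power2_eq_square)
  finally show ?thesis .
qed

text \<open>Polarisation: it turns the inner products produced by proximal steps into telescoping
  squared distances.\<close>

lemma inner_three_point:
  fixes a b c :: "'a::real_inner"
  shows "(a - b) \<bullet> (b - c) = ((norm (a - c))\<^sup>2 - (norm (b - c))\<^sup>2 - (norm (b - a))\<^sup>2) / 2"
  unfolding power2_norm_eq_inner by (simp add: inner_diff inner_commute)

lemma norm_diff_sq_le:
  fixes a b c :: "'a::real_inner"
  shows "(norm (a - c))\<^sup>2 \<le> 2 * (norm (a - b))\<^sup>2 + 2 * (norm (b - c))\<^sup>2"
proof -
  have "0 \<le> (norm ((a - b) - (b - c)))\<^sup>2" by simp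
  then show ?thesis unfolding power2_norm_eq_inner by (simp add: inner_diff inner_commute)
qed

lemma norm_adjoint_le:
  fixes A :: "'x::euclidean_space \<Rightarrow> 'y::euclidean_space"
  assumes "linear A"
  shows "norm (adjoint A v) \<le> onorm A * norm v"
proof (cases "adjoint A v = 0")
  case True
  then show ?thesis
    using onorm_pos_le[of A] assms by (simp add: linear_conv_bounded_linear)
next
  case False
  have "(norm (adjoint A v))\<^sup>2 = A (adjoint A v) \<bullet> v"
    using assms by (simp add: power2_norm_eq_inner adjoint_works)
  also have "\<dots> \<le> norm (A (adjoint A v)) * norm v" by (rule norm_cauchy_schwarz)
  also have "\<dots> \<le> (onorm A * norm (adjoint A v)) * norm v"
    using assms by (intro mult_right_mono onorm) (auto simp: linear_conv_bounded_linear)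
  finally show ?thesis using False by (simp add: power2_eq_square)
qed

lemma sum_fun_upd_eq:
  fixes \<phi> :: "'i \<Rightarrow> 'a \<Rightarrow> 'b::ab_group_add"
  assumes "finite I" "j \<in> I"
  shows "(\<Sum>i\<in>I. \<phi> i ((y(j := v)) i)) = (\<Sum>i\<in>I. \<phi> i (y i)) + (\<phi> j v - \<phi> j (y j))"
proof -
  have "(\<Sum>i\<in>I - {j}. \<phi> i ((y(j := v)) i)) = (\<Sum>i\<in>I - {j}. \<phi> i (y i))"
    by (intro sum.cong) auto
  then show ?thesis using assms by (simp add: sum.remove[of I j])
qed

lemma tendsto_0_of_norm_sq_le:
  fixes v :: "nat \<Rightarrow> 'a::real_normed_vector"
  assumes le: "\<And>k. (norm (v k))\<^sup>2 \<le> D k" and D: "D \<longlonglongrightarrow> 0"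
  shows "v \<longlonglongrightarrow> 0"
proof (rule Lim_null_comparison)
  show "\<forall>\<^sub>F k in sequentially. norm (v k) \<le> sqrt (D k)"
    using le by (intro always_eventually allI real_le_rsqrt)
  show "(\<lambda>k. sqrt (D k)) \<longlonglongrightarrow> 0" using tendsto_real_sqrt[OF D] by simp
qed

text \<open>Only finitely many components of the dual variable are controlled, so compactness is
  used one component at a time, refining the subsequence at each step.\<close>

lemma common_convergent_subseq:
  fixes u :: "'i \<Rightarrow> nat \<Rightarrow> 'a::heine_borel"
  assumes "finite I" "\<And>i. i \<in> I \<Longrightarrow> bounded (range (u i))"
  shows "\<exists>r l. strict_mono r \<and> (\<forall>i\<in>I. (\<lambda>k. u i (r k)) \<longlonglongrightarrow> l i)"
  using assms
proof (induction I rule: finite_induct)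
  case empty
  show ?case by (rule exI[of _ id]) (simp add: strict_mono_def)
next
  case (insert j I)
  then obtain r l where r: "strict_mono r" "\<forall>i\<in>I. (\<lambda>k. u i (r k)) \<longlonglongrightarrow> l i" by auto
  have "bounded (range (\<lambda>k. u j (r k)))"
    by (rule bounded_subset[of "range (u j)"]) (use insert.prems in auto)
  then obtain l' r' where r': "strict_mono r'" "((\<lambda>k. u j (r k)) \<circ> r') \<longlonglongrightarrow> l'"
    using bounded_imp_convergent_subsequence by blast
  have "strict_mono (r \<circ> r')" using r(1) r'(1) by (rule strict_mono_o)
  moreover have "(\<lambda>k. u i ((r \<circ> r') k)) \<longlonglongrightarrow> (l(j := l')) i" if "i \<in> insert j I" for i
  proof (cases "i = j")
    case True
    then show ?thesis using r'(2) by (simp add: comp_def)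
  next
    case False
    then show ?thesis
      using that r(2) LIMSEQ_subseq_LIMSEQ[OF _ r'(1), of "\<lambda>k. u i (r k)"] by (simp add: comp_def)
  qed
  ultimately show ?case by blast
qed

lemma countable_dense_subset:
  fixes S :: "'a::second_countable_topology set"
  shows "\<exists>D. countable D \<and> D \<subseteq> S \<and> S \<subseteq> closure D"
proof -
  obtain B :: "'a set set" where B: "countable B" "topological_basis B"
    using ex_countable_basis by blast
  define D where "D = (\<lambda>b. SOME x. x \<in> b \<inter> S) ` {b \<in> B. b \<inter> S \<noteq> {}}"
  have some: "(SOME x. x \<in> b \<inter> S) \<in> b \<inter> S" if "b \<inter> S \<noteq> {}" for b
    by (rule some_in_eq[THEN iffD2, OF that])
  have "x \<in> closure D" if x: "x \<in> S" for x
    unfolding closure_iff_nhds_not_empty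
  proof (intro allI impI)
    fix V U assume U: "U \<subseteq> V" "open U" "x \<in> U"
    obtain b where b: "b \<in> B" "x \<in> b" "b \<subseteq> U"
      using topological_basisE[OF B(2) U(2,3)] by blast
    then have "(SOME x. x \<in> b \<inter> S) \<in> D \<inter> V"
      using some[of b] x U(1) by (auto simp: D_def)
    then show "D \<inter> V \<noteq> {}" by blast
  qed
  moreover have "D \<subseteq> S" using some by (auto simp: D_def)
  moreover have "countable D" unfolding D_def using B(1) by simp
  ultimately show ?thesis by blast
qed

subsection \<open>Saddle points as pairs of subgradient inclusions\<close>

locale spdhg_problem =
  fixes n :: nat
    and S :: "nat \<Rightarrow> 'y::euclidean_space set"
    and A :: "nat \<Rightarrow> 'x::euclidean_space \<Rightarrow> 'y"
    and g :: "'x \<Rightarrow> ereal"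
    and f :: "nat \<Rightarrow> 'y \<Rightarrow> ereal"
    and p :: "nat \<Rightarrow> real" and \<tau> :: real and \<sigma> :: "nat \<Rightarrow> real"
  assumes subsp: "i \<in> {1..n} \<Longrightarrow> subspace (S i)"
    and linA: "i \<in> {1..n} \<Longrightarrow> linear (A i)"
    and g_cvx: "ext_convex_on UNIV g" and g_proper: "proper_on UNIV g" and g_lsc: "lsc_on UNIV g"
    and f_cvx: "i \<in> {1..n} \<Longrightarrow> ext_convex_on (S i) (f i)"
    and f_proper: "i \<in> {1..n} \<Longrightarrow> proper_on (S i) (f i)"
    and f_lsc: "i \<in> {1..n} \<Longrightarrow> lsc_on (S i) (f i)"
    and p_pos: "i \<in> {1..n} \<Longrightarrow> p i > 0" and p_sum: "(\<Sum>i\<in>{1..n}. p i) = 1"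
    and tau_pos: "\<tau> > 0" and sigma_pos: "i \<in> {1..n} \<Longrightarrow> \<sigma> i > 0"
    and step_bound: "i \<in> {1..n} \<Longrightarrow> \<tau> * \<sigma> i * (onorm (A i))\<^sup>2 < p i"
begin

abbreviation h :: "nat \<Rightarrow> 'y \<Rightarrow> ereal" where "h i \<equiv> conj_on (S i) (f i)"

lemma h_proper: "i \<in> {1..n} \<Longrightarrow> proper_on (S i) (h i)"
  by (intro conj_on_proper subsp f_cvx f_proper f_lsc)

lemma h_real:
  assumes "i \<in> {1..n}" "y \<in> S i" "h i y \<noteq> \<infinity>"
  shows "h i y = ereal (real_of_ereal (h i y))"
proof -
  obtain b where "h i y = ereal b" using proper_on_real[OF h_proper[OF assms(1)] assms(2,3)] .
  then show ?thesis by simp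
qed

lemma h_lsc: "i \<in> {1..n} \<Longrightarrow> lsc_on (S i) (h i)"
  by (intro conj_on_lsc f_proper)

lemma h_prox: "i \<in> {1..n} \<Longrightarrow>
    subgrad_on (S i) (h i) (prox_on (S i) (\<sigma> i) (h i) v) ((1 / \<sigma> i) *\<^sub>R (v - prox_on (S i) (\<sigma> i) (h i) v))"
  by (intro prox_on_subgrad subsp conj_on_convex f_proper h_proper h_lsc sigma_pos)

lemma g_prox: "subgrad_on UNIV g (prox_on UNIV \<tau> g v) ((1 / \<tau>) *\<^sub>R (v - prox_on UNIV \<tau> g v))"
  by (rule prox_on_subgrad) (use g_cvx g_proper g_lsc tau_pos in auto)

definition AT :: "(nat \<Rightarrow> 'y) \<Rightarrow> 'x" where
  "AT y = (\<Sum>i\<in>{1..n}. adjoint (A i) (y i))"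

lemma AT_inner: "AT y \<bullet> x = (\<Sum>i\<in>{1..n}. A i x \<bullet> y i)"
  unfolding AT_def inner_sum_left
  by (intro sum.cong) (auto simp: adjoint_clauses[OF linA] inner_commute)

lemma bounded_linear_adjoint: "i \<in> {1..n} \<Longrightarrow> bounded_linear (adjoint (A i))"
  using adjoint_linear[OF linA] linear_conv_bounded_linear by blast

lemma AT_tendsto:
  assumes "\<And>i. i \<in> {1..n} \<Longrightarrow> (\<lambda>k. y k i) \<longlonglongrightarrow> y' i"
  shows "(\<lambda>k. AT (y k)) \<longlonglongrightarrow> AT y'"
  unfolding AT_def
  by (intro tendsto_sum bounded_linear.tendsto[OF bounded_linear_adjoint] assms)

definition kkt :: "'x \<Rightarrow> (nat \<Rightarrow> 'y) \<Rightarrow> bool" where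
  "kkt x y \<longleftrightarrow> subgrad_on UNIV g x (- AT y) \<and> (\<forall>i\<in>{1..n}. subgrad_on (S i) (h i) (y i) (A i x))"

lemma lagrangian_real:
  assumes "g x = ereal a" "\<And>i. i \<in> {1..n} \<Longrightarrow> h i (y i) = ereal (b i)"
  shows "lagrangian n S A g f x y = ereal ((\<Sum>i\<in>{1..n}. A i x \<bullet> y i - b i) + a)"
proof -
  have "(\<Sum>i\<in>{1..n}. ereal (A i x \<bullet> y i) - h i (y i)) = (\<Sum>i\<in>{1..n}. ereal (A i x \<bullet> y i - b i))"
    using assms(2) by (intro sum.cong) auto
  then show ?thesis by (simp add: lagrangian_def assms(1))
qed

text \<open>In \<open>ereal\<close> the value \<infinity> absorbs -\<infinity> under addition, so
  all other summands must be kept away from \<infinity>.\<close>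

lemma ereal_sum_minus_infty:
  fixes t :: "nat \<Rightarrow> ereal"
  assumes "\<And>i. i \<in> {1..n} \<Longrightarrow> t i \<noteq> \<infinity>" "j \<in> {1..n}" "t j = -\<infinity>"
  shows "sum t {1..n} = -\<infinity>"
proof -
  have "sum t ({1..n} - {j}) \<noteq> \<infinity>" using assms(1) by (simp add: sum_Pinfty)
  then show ?thesis by (subst sum.remove[OF _ assms(2)]) (simp_all add: assms(3))
qed

text \<open>The real work is finiteness: comparison with domain points of \<open>g\<close> and of
  the conjugates makes the Lagrangian finite at the saddle point, hence each of its terms. After
  that the two saddle inequalities are the subgradient inequalities.\<close>

lemma saddle_imp_kkt:
  assumes sp: "saddle_point n S A g f xs ys"
  shows "kkt xs ys"
proof -
  have ysS: "ys i \<in> S i" if "i \<in> {1..n}" for i using sp that by (auto simp: saddle_point_def in_Y_def)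
  have max: "lagrangian n S A g f xs y \<le> lagrangian n S A g f xs ys" if "in_Y n S y" for y
    using sp that by (auto simp: saddle_point_def)
  have min: "lagrangian n S A g f xs ys \<le> lagrangian n S A g f x ys" for x
    using sp by (auto simp: saddle_point_def)
  have term_fin: "ereal r - h i y \<noteq> \<infinity>" if "i \<in> {1..n}" "y \<in> S i" for i y r
    using h_proper[OF that(1)] that(2) by (cases "h i y") (auto simp: proper_on_def)
  obtain x1 where x1: "g x1 \<noteq> \<infinity>" using g_proper by (auto simp: proper_on_def)
  have "lagrangian n S A g f x1 ys \<noteq> \<infinity>"
    using x1 term_fin ysS by (auto simp: lagrangian_def sum_Pinfty)
  then have "lagrangian n S A g f xs ys \<noteq> \<infinity>" using min[of x1] ereal_infty_less_eq(1) by metis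
  \<comment> \<open>A value \<infinity> of \<open>g\<close> would absorb the dual sum and make the
    Lagrangian infinite.\<close>
  then have "g xs \<noteq> \<infinity>" unfolding lagrangian_def by (rule contrapos_nn) simp
  then obtain a where a: "g xs = ereal a" using proper_on_real[OF g_proper] by blast
  define y1 where "y1 i = (SOME y. y \<in> S i \<and> h i y \<noteq> \<infinity>)" for i
  have y1: "y1 i \<in> S i \<and> h i (y1 i) \<noteq> \<infinity>" if "i \<in> {1..n}" for i
    unfolding y1_def by (rule someI_ex) (use h_proper[OF that] in \<open>auto simp: proper_on_def\<close>)
  have "lagrangian n S A g f xs y1 \<noteq> -\<infinity>"
    using lagrangian_real[OF a h_real, of y1] y1 by auto
  then have Lfin: "lagrangian n S A g f xs ys \<noteq> -\<infinity>"
    using max[of y1] y1 by (auto simp: in_Y_def)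
  have h_fin: "h i (ys i) \<noteq> \<infinity>" if i: "i \<in> {1..n}" for i
  proof
    assume "h i (ys i) = \<infinity>"
    then have "(\<Sum>i\<in>{1..n}. ereal (A i xs \<bullet> ys i) - h i (ys i)) = -\<infinity>"
      using i term_fin ysS by (intro ereal_sum_minus_infty) auto
    then show False using Lfin a by (simp add: lagrangian_def)
  qed
  define b where "b i = real_of_ereal (h i (ys i))" for i
  have b: "h i (ys i) = ereal (b i)" if "i \<in> {1..n}" for i
    unfolding b_def by (rule h_real) (use that ysS h_fin in auto)
  have L: "lagrangian n S A g f xs ys = ereal ((\<Sum>i\<in>{1..n}. A i xs \<bullet> ys i - b i) + a)"
    by (rule lagrangian_real[OF a]) (rule b)
  have "g xs + ereal ((- AT ys) \<bullet> (x - xs)) \<le> g x" for x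
  proof (cases "g x = \<infinity>")
    case False
    then obtain c where c: "g x = ereal c" using proper_on_real[OF g_proper] by blast
    have "lagrangian n S A g f x ys = ereal ((\<Sum>i\<in>{1..n}. A i x \<bullet> ys i - b i) + c)"
      by (rule lagrangian_real[OF c]) (rule b)
    then show ?thesis using min[of x] L
      by (simp add: a c inner_diff_right AT_inner sum_subtractf)
  qed simp
  then have 1: "subgrad_on UNIV g xs (- AT ys)" using a by (auto simp: subgrad_on_def)
  have 2: "subgrad_on (S i) (h i) (ys i) (A i xs)" if i: "i \<in> {1..n}" for i
  proof -
    have "h i (ys i) + ereal (A i xs \<bullet> (w - ys i)) \<le> h i w" if w: "w \<in> S i" for w
    proof (cases "h i w = \<infinity>")
      case False
      then obtain c where c: "h i w = ereal c" using proper_on_real[OF h_proper[OF i] w] by blast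
      \<comment> \<open>Moving a single dual component leaves the other summands unchanged, so the
        joint maximality separates over the indices.\<close>
      let ?y = "ys(i := w)" and ?b = "b(i := c)"
      have b': "h j (?y j) = ereal (?b j)" if "j \<in> {1..n}" for j using b c that by auto
      have "lagrangian n S A g f xs ?y = ereal ((\<Sum>i\<in>{1..n}. A i xs \<bullet> ?y i - ?b i) + a)"
        by (rule lagrangian_real[OF a]) (rule b')
      moreover have "in_Y n S ?y" using w ysS by (auto simp: in_Y_def)
      ultimately have "(\<Sum>j\<in>{1..n}. A j xs \<bullet> ?y j - ?b j) \<le> (\<Sum>j\<in>{1..n}. A j xs \<bullet> ys j - b j)"
        using max[of ?y] L by (simp del: fun_upd_apply)
      moreover have "(\<Sum>j\<in>{1..n}. A j xs \<bullet> ?y j - ?b j)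
          = (A i xs \<bullet> w - c) + (\<Sum>j\<in>{1..n} - {i}. A j xs \<bullet> ys j - b j)"
      proof -
        have "(\<Sum>j\<in>{1..n} - {i}. A j xs \<bullet> ?y j - ?b j) = (\<Sum>j\<in>{1..n} - {i}. A j xs \<bullet> ys j - b j)"
          by (intro sum.cong) auto
        then show ?thesis by (subst sum.remove[OF _ i]) simp_all
      qed
      moreover have "(\<Sum>j\<in>{1..n}. A j xs \<bullet> ys j - b j)
          = (A i xs \<bullet> ys i - b i) + (\<Sum>j\<in>{1..n} - {i}. A j xs \<bullet> ys j - b j)"
        by (rule sum.remove[OF _ i]) simp
      ultimately have "A i xs \<bullet> w - c \<le> A i xs \<bullet> ys i - b i" by linarith
      then show ?thesis using b[OF i] c by (simp add: inner_diff_right)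
    qed simp
    then show ?thesis using b[OF i] ysS[OF i] by (auto simp: subgrad_on_def)
  qed
  show ?thesis using 1 2 by (simp add: kkt_def)
qed

lemma kkt_imp_saddle:
  assumes kkt: "kkt xs ys"
  shows "saddle_point n S A g f xs ys"
proof -
  have ysS: "in_Y n S ys" using kkt by (auto simp: kkt_def subgrad_on_def in_Y_def)
  obtain a where a: "g xs = ereal a" using kkt by (auto simp: kkt_def subgrad_on_def)
  define b where "b i = real_of_ereal (h i (ys i))" for i
  have b: "h i (ys i) = ereal (b i)" if "i \<in> {1..n}" for i
    using kkt that by (auto simp: b_def kkt_def subgrad_on_def ereal_real')
  have L: "lagrangian n S A g f xs ys = ereal ((\<Sum>i\<in>{1..n}. A i xs \<bullet> ys i - b i) + a)"
    by (rule lagrangian_real[OF a]) (rule b)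
  have "lagrangian n S A g f xs y \<le> lagrangian n S A g f xs ys" if y: "in_Y n S y" for y
    unfolding lagrangian_def
  proof (intro add_right_mono sum_mono)
    fix i assume i: "i \<in> {1..n}"
    then have "ereal (b i) + ereal (A i xs \<bullet> (y i - ys i)) \<le> h i (y i)"
      using kkt y i unfolding b[OF i, symmetric] kkt_def subgrad_on_def in_Y_def by blast
    then show "ereal (A i xs \<bullet> y i) - h i (y i) \<le> ereal (A i xs \<bullet> ys i) - h i (ys i)"
      using b[OF i] by (cases "h i (y i)") (auto simp: inner_diff_right)
  qed
  moreover have "lagrangian n S A g f xs ys \<le> lagrangian n S A g f x ys" for x
  proof (cases "g x = \<infinity>")
    case True
    then show ?thesis by (simp add: lagrangian_def)
  next
    case False
    then obtain c where c: "g x = ereal c" using proper_on_real[OF g_proper] by blast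
    moreover have "g xs + ereal ((- AT ys) \<bullet> (x - xs)) \<le> g x" using kkt by (auto simp: kkt_def subgrad_on_def)
    moreover have "lagrangian n S A g f x ys = ereal ((\<Sum>i\<in>{1..n}. A i x \<bullet> ys i - b i) + c)"
      by (rule lagrangian_real[OF c]) (rule b)
    ultimately show ?thesis using L
      by (simp add: a c inner_diff_right AT_inner sum_subtractf)
  qed
  ultimately show ?thesis using ysS by (auto simp: saddle_point_def)
qed

subsection \<open>The Lyapunov function\<close>

text \<open>On iterates \<open>extrap t\<close> is \<open>(1 / p j) *\<^sub>R \<delta>\<close> for the last drawn index \<open>j\<close>; together with
  \<open>z = AT y\<close> it determines \<open>zb\<close>.\<close>

definition extrap :: "'x \<times> (nat \<Rightarrow> 'y) \<times> 'x \<times> 'x \<Rightarrow> 'x" where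
  "extrap t = snd (snd (snd t)) - fst (snd (snd t))"

definition x_next :: "'x \<times> (nat \<Rightarrow> 'y) \<times> 'x \<times> 'x \<Rightarrow> 'x" where
  "x_next t = prox_on UNIV \<tau> g (fst t - \<tau> *\<^sub>R snd (snd (snd t)))"

text \<open>A candidate for every index, not only the drawn one: the expectation over the next draw
  involves all of them.\<close>

definition y_next :: "'x \<times> (nat \<Rightarrow> 'y) \<times> 'x \<times> 'x \<Rightarrow> nat \<Rightarrow> 'y" where
  "y_next t i = prox_on (S i) (\<sigma> i) (h i) (fst (snd t) i + \<sigma> i *\<^sub>R A i (x_next t))"

definition update :: "'x \<times> (nat \<Rightarrow> 'y) \<times> 'x \<times> 'x \<Rightarrow> nat \<Rightarrow> 'x \<times> (nat \<Rightarrow> 'y) \<times> 'x \<times> 'x" where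
  "update t j = (let \<delta> = adjoint (A j) (y_next t j - fst (snd t) j); z = fst (snd (snd t)) + \<delta>
     in (x_next t, (fst (snd t))(j := y_next t j), z, z + (1 / p j) *\<^sub>R \<delta>))"

lemma spdhg_eq_iterate:
  "spdhg S A g f p \<tau> \<sigma> x0 js k = iterate update (x0, (\<lambda>i. 0), 0, 0) js k"
proof (induction k)
  case (Suc k)
  obtain x y z zb where t: "iterate update (x0, (\<lambda>i. 0), 0, 0) js k = (x, y, z, zb)"
    using prod_cases4 by blast
  show ?case unfolding spdhg.simps iterate.simps Suc t
    by (simp add: update_def y_next_def x_next_def Let_def)
qed simp

lemma fst_update: "fst (update t j) = x_next t"
  and y_update: "fst (snd (update t j)) = (fst (snd t))(j := y_next t j)"
  and z_update: "fst (snd (snd (update t j)))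
    = fst (snd (snd t)) + adjoint (A j) (y_next t j - fst (snd t) j)"
  and extrap_update: "extrap (update t j) = (1 / p j) *\<^sub>R adjoint (A j) (y_next t j - fst (snd t) j)"
  by (auto simp: update_def Let_def extrap_def)

text \<open>\<open>z\<close> accumulates exactly the adjoint images of the dual increments, so it
  always equals \<open>AT\<close> of the dual variable; the extrapolated point is then that image
  plus \<open>extrap\<close>.\<close>

definition reach :: "('x \<times> (nat \<Rightarrow> 'y) \<times> 'x \<times> 'x) set" where
  "reach = {t. in_Y n S (fst (snd t)) \<and> fst (snd (snd t)) = AT (fst (snd t))}"

lemma y_next_in: "i \<in> {1..n} \<Longrightarrow> y_next t i \<in> S i"
  using h_prox unfolding y_next_def subgrad_on_def by blast

lemma reach_init: "(x0, (\<lambda>i. 0), 0, 0) \<in> reach"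
proof -
  have "AT (\<lambda>i. 0) = 0"
    unfolding AT_def by (intro sum.neutral ballI linear_0 adjoint_linear linA)
  then show ?thesis using subspace_0[OF subsp] by (auto simp: reach_def in_Y_def)
qed

lemma reach_update:
  assumes t: "t \<in> reach" and j: "j \<in> {1..n}"
  shows "update t j \<in> reach"
proof -
  have "AT (fst (snd (update t j))) = AT (fst (snd t))
      + (adjoint (A j) (y_next t j) - adjoint (A j) (fst (snd t) j))"
    unfolding AT_def y_update by (rule sum_fun_upd_eq) (use j in auto)
  also have "adjoint (A j) (y_next t j) - adjoint (A j) (fst (snd t) j)
      = adjoint (A j) (y_next t j - fst (snd t) j)"
    by (rule linear_diff[symmetric]) (rule adjoint_linear[OF linA[OF j]])
  finally have "fst (snd (snd (update t j))) = AT (fst (snd (update t j)))"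
    using t by (simp add: z_update reach_def)
  moreover have "in_Y n S (fst (snd (update t j)))"
    using t y_next_in by (auto simp: y_update reach_def in_Y_def)
  ultimately show ?thesis by (simp add: reach_def)
qed

text \<open>Dual component \<open>i\<close> moves only with probability \<open>p i\<close>. The
  extra factor \<open>p i\<close> in the denominator compensates for this, so that on average the
  step counts like a full dual update with weights \<open>1 / (2 * \<sigma> i)\<close>.\<close>

definition wdist :: "'x \<Rightarrow> (nat \<Rightarrow> 'y) \<Rightarrow> 'x \<Rightarrow> (nat \<Rightarrow> 'y) \<Rightarrow> real" where
  "wdist x y x' y' = (norm (x - x'))\<^sup>2 / (2 * \<tau>) + (\<Sum>i\<in>{1..n}. (norm (y i - y' i))\<^sup>2 / (2 * \<sigma> i * p i))"

text \<open>Averaged over the draw, the cross term of the new state cancels the coupling of the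
  primal error with the candidate dual increments; that of the old state absorbs the extrapolation
  in the primal step. The last coefficient is the price of Young's inequality with parameter
  \<open>\<gamma> / \<tau>\<close>.\<close>

definition lyap :: "real \<Rightarrow> 'x \<Rightarrow> (nat \<Rightarrow> 'y) \<Rightarrow> 'x \<times> (nat \<Rightarrow> 'y) \<times> 'x \<times> 'x \<Rightarrow> real" where
  "lyap \<gamma> xs ys t = wdist (fst t) (fst (snd t)) xs ys - (fst t - xs) \<bullet> extrap t
     + \<tau> / (2 * \<gamma>) * (norm (extrap t))\<^sup>2"

text \<open>For draws from \<open>p\<close> this is 1 - \<gamma> times the expected
  \<open>wdist\<close> between a state and its successor, which is why no \<open>p i\<close>
  remains.\<close>

definition decr :: "real \<Rightarrow> 'x \<times> (nat \<Rightarrow> 'y) \<times> 'x \<times> 'x \<Rightarrow> real" where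
  "decr \<gamma> t = (1 - \<gamma>) * ((norm (x_next t - fst t))\<^sup>2 / (2 * \<tau>)
     + (\<Sum>i\<in>{1..n}. (norm (y_next t i - fst (snd t) i))\<^sup>2 / (2 * \<sigma> i)))"

text \<open>Monotonicity of the subdifferentials cancels all function values, so the iterates need not
  lie in the domains of the functionals.\<close>
lemma one_step_inequality:
  assumes t: "t \<in> reach" and kkt: "kkt xs ys"
  defines "x \<equiv> fst t" and "y \<equiv> fst (snd t)" and "q \<equiv> extrap t"
    and "x' \<equiv> x_next t" and "yh \<equiv> y_next t"
  shows "0 \<le> ((norm (x - xs))\<^sup>2 - (norm (x' - xs))\<^sup>2 - (norm (x' - x))\<^sup>2) / (2 * \<tau>)
    + (\<Sum>i\<in>{1..n}. ((norm (y i - ys i))\<^sup>2 - (norm (yh i - ys i))\<^sup>2 - (norm (yh i - y i))\<^sup>2) / (2 * \<sigma> i))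
    + (\<Sum>i\<in>{1..n}. A i (x' - xs) \<bullet> (yh i - y i)) - q \<bullet> (x' - xs)"
proof -
  define zb where "zb = snd (snd (snd t))"
  have zb: "zb = AT y + q" using t by (simp add: zb_def q_def y_def extrap_def reach_def)
  have "0 \<le> ((1 / \<tau>) *\<^sub>R ((x - \<tau> *\<^sub>R zb) - x') - (- AT ys)) \<bullet> (x' - xs)"
    unfolding x'_def x_def zb_def x_next_def
    by (rule subgrad_on_monotone[OF g_prox]) (use kkt in \<open>auto simp: kkt_def\<close>)
  also have "\<dots> = (1 / \<tau>) * ((x - x') \<bullet> (x' - xs)) - (AT y \<bullet> (x' - xs) - AT ys \<bullet> (x' - xs)) - q \<bullet> (x' - xs)"
    using tau_pos unfolding zb by (simp add: inner_simps field_simps)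
  also have "AT y \<bullet> (x' - xs) - AT ys \<bullet> (x' - xs) = (\<Sum>i\<in>{1..n}. A i (x' - xs) \<bullet> (y i - ys i))"
    unfolding AT_inner by (simp add: inner_diff_right sum_subtractf)
  finally have P: "0 \<le> ((norm (x - xs))\<^sup>2 - (norm (x' - xs))\<^sup>2 - (norm (x' - x))\<^sup>2) / (2 * \<tau>)
      - (\<Sum>i\<in>{1..n}. A i (x' - xs) \<bullet> (y i - ys i)) - q \<bullet> (x' - xs)"
    by (simp add: inner_three_point)
  have D: "0 \<le> ((norm (y i - ys i))\<^sup>2 - (norm (yh i - ys i))\<^sup>2 - (norm (yh i - y i))\<^sup>2) / (2 * \<sigma> i)
      + A i (x' - xs) \<bullet> (yh i - y i) + A i (x' - xs) \<bullet> (y i - ys i)" if i: "i \<in> {1..n}" for i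
  proof -
    have "0 \<le> ((1 / \<sigma> i) *\<^sub>R ((y i + \<sigma> i *\<^sub>R A i x') - yh i) - A i xs) \<bullet> (yh i - ys i)"
      unfolding yh_def y_next_def y_def x'_def
      by (rule subgrad_on_monotone[OF h_prox[OF i]]) (use kkt i in \<open>auto simp: kkt_def\<close>)
    also have "\<dots> = (1 / \<sigma> i) * ((y i - yh i) \<bullet> (yh i - ys i)) + A i (x' - xs) \<bullet> (yh i - ys i)"
      using sigma_pos[OF i] by (simp add: inner_simps field_simps linear_diff[OF linA[OF i]])
    also have "A i (x' - xs) \<bullet> (yh i - ys i) = A i (x' - xs) \<bullet> (yh i - y i) + A i (x' - xs) \<bullet> (y i - ys i)"
      by (simp add: inner_diff_right)
    finally show ?thesis by (simp add: inner_three_point)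
  qed
  \<comment> \<open>The products of \<open>A i (x' - xs)\<close> with \<open>y i - ys i\<close>
    occur with opposite signs in \<open>P\<close> and \<open>D\<close> and cancel on
    summation.\<close>
  have "0 \<le> (\<Sum>i\<in>{1..n}. ((norm (y i - ys i))\<^sup>2 - (norm (yh i - ys i))\<^sup>2 - (norm (yh i - y i))\<^sup>2) / (2 * \<sigma> i)
      + A i (x' - xs) \<bullet> (yh i - y i) + A i (x' - xs) \<bullet> (y i - ys i))"
    by (intro sum_nonneg D)
  then show ?thesis using P by (simp only: sum.distrib)
qed

text \<open>The factor \<open>p j\<close> cancels the inverse probabilities in the dual weight and
  in the cross term. The quadratic term keeps one factor \<open>1 / p j\<close>, which the step size
  condition absorbs.\<close>

lemma lyap_update_le:
  fixes t :: "'x \<times> (nat \<Rightarrow> 'y) \<times> 'x \<times> 'x"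
  assumes j: "j \<in> {1..n}" and \<gamma>: "0 < \<gamma>" "\<tau> * \<sigma> j * (onorm (A j))\<^sup>2 \<le> \<gamma>\<^sup>2 * p j"
  defines "x \<equiv> fst t" and "y \<equiv> fst (snd t)" and "x' \<equiv> x_next t" and "yh \<equiv> y_next t"
  shows "p j * lyap \<gamma> xs ys (update t j) \<le> p j * wdist x' y xs ys
    + ((norm (yh j - ys j))\<^sup>2 - (norm (y j - ys j))\<^sup>2) / (2 * \<sigma> j)
    - A j (x' - xs) \<bullet> (yh j - y j) + \<gamma> * ((norm (yh j - y j))\<^sup>2 / (2 * \<sigma> j))"
proof -
  define v where "v = adjoint (A j) (yh j - y j)"
  have pj: "0 < p j" and sj: "0 < \<sigma> j" using j p_pos sigma_pos by auto
  have w: "wdist x' (y(j := yh j)) xs ys = wdist x' y xs ys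
      + ((norm (yh j - ys j))\<^sup>2 / (2 * \<sigma> j * p j) - (norm (y j - ys j))\<^sup>2 / (2 * \<sigma> j * p j))"
  proof -
    have "(\<Sum>i\<in>{1..n}. (norm ((y(j := yh j)) i - ys i))\<^sup>2 / (2 * \<sigma> i * p i))
        = (\<Sum>i\<in>{1..n}. (norm (y i - ys i))\<^sup>2 / (2 * \<sigma> i * p i))
        + ((norm (yh j - ys j))\<^sup>2 / (2 * \<sigma> j * p j) - (norm (y j - ys j))\<^sup>2 / (2 * \<sigma> j * p j))"
      by (rule sum_fun_upd_eq[where \<phi> = "\<lambda>i v. (norm (v - ys i))\<^sup>2 / (2 * \<sigma> i * p i)"]) (use j in auto)
    then show ?thesis by (simp only: wdist_def add.assoc)
  qed
  have l: "lyap \<gamma> xs ys (update t j) = wdist x' (y(j := yh j)) xs ys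
      - (x' - xs) \<bullet> ((1 / p j) *\<^sub>R v) + \<tau> / (2 * \<gamma>) * (norm ((1 / p j) *\<^sub>R v))\<^sup>2"
    by (simp only: lyap_def fst_update y_update extrap_update v_def x'_def yh_def y_def)
  have adj: "(x' - xs) \<bullet> v = A j (x' - xs) \<bullet> (yh j - y j)"
    unfolding v_def by (rule adjoint_works[OF linA[OF j]])
  have "norm v \<le> onorm (A j) * norm (yh j - y j)"
    unfolding v_def by (rule norm_adjoint_le[OF linA[OF j]])
  then have "(norm v)\<^sup>2 \<le> (onorm (A j) * norm (yh j - y j))\<^sup>2" by (intro power_mono) auto
  then have "\<tau> * \<sigma> j * (norm v)\<^sup>2 \<le> \<tau> * \<sigma> j * ((onorm (A j))\<^sup>2 * (norm (yh j - y j))\<^sup>2)"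
    using tau_pos sj by (intro mult_left_mono) (auto simp: power_mult_distrib)
  also have "\<dots> \<le> \<gamma>\<^sup>2 * p j * (norm (yh j - y j))\<^sup>2"
    using mult_right_mono[OF \<gamma>(2), of "(norm (yh j - y j))\<^sup>2"] by (simp add: mult.assoc)
  finally have "\<tau> * \<sigma> j * (norm v)\<^sup>2 \<le> \<gamma>\<^sup>2 * p j * (norm (yh j - y j))\<^sup>2" .
  \<comment> \<open>The square of \<gamma> in the step size bound arises here: one factor cancels
    the \<gamma> in the denominator of the quadratic term, the other remains on the right.\<close>
  then have N: "\<tau> / (2 * \<gamma>) * ((norm v)\<^sup>2 / p j) \<le> \<gamma> * ((norm (yh j - y j))\<^sup>2 / (2 * \<sigma> j))"
    using \<gamma>(1) pj sj by (simp add: field_simps power2_eq_square)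
  have "p j * lyap \<gamma> xs ys (update t j) = p j * wdist x' y xs ys
      + ((norm (yh j - ys j))\<^sup>2 - (norm (y j - ys j))\<^sup>2) / (2 * \<sigma> j)
      - (x' - xs) \<bullet> v + \<tau> / (2 * \<gamma>) * ((norm v)\<^sup>2 / p j)"
    unfolding l w using pj sj by (simp add: field_simps power2_eq_square)
  then show ?thesis using N adj by simp
qed

text \<open>Adding the averaged update bound to the one-step inequality cancels \<open>E1\<close>,
  \<open>E2\<close> and \<open>C\<close>. What remains is the mismatch
  \<open>(x - x') \<bullet> q\<close>, because the stored cross term refers to the old primal point;
  Young's inequality pays for it with \<open>\<gamma> * d\<close> and the stored quadratic
  term.\<close>

lemma lyap_drift:
  assumes t: "t \<in> reach" and kkt: "kkt xs ys" and \<gamma>: "0 < \<gamma>"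
    "\<forall>i\<in>{1..n}. \<tau> * \<sigma> i * (onorm (A i))\<^sup>2 \<le> \<gamma>\<^sup>2 * p i"
  shows "(\<Sum>j\<in>{1..n}. p j * lyap \<gamma> xs ys (update t j)) + decr \<gamma> t \<le> lyap \<gamma> xs ys t"
proof -
  define x y q x' yh where "x = fst t" and "y = fst (snd t)" and "q = extrap t"
    and "x' = x_next t" and "yh = y_next t"
  note defs = x_def y_def q_def x'_def yh_def
  define E1 E2 E3 C where "E1 = (\<Sum>i\<in>{1..n}. (norm (yh i - ys i))\<^sup>2 / (2 * \<sigma> i))"
    and "E2 = (\<Sum>i\<in>{1..n}. (norm (y i - ys i))\<^sup>2 / (2 * \<sigma> i))"
    and "E3 = (\<Sum>i\<in>{1..n}. (norm (yh i - y i))\<^sup>2 / (2 * \<sigma> i))"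
    and "C = (\<Sum>i\<in>{1..n}. A i (x' - xs) \<bullet> (yh i - y i))"
  define d where "d = (norm (x' - x))\<^sup>2 / (2 * \<tau>)"
  have "(\<Sum>j\<in>{1..n}. p j * lyap \<gamma> xs ys (update t j)) \<le> (\<Sum>j\<in>{1..n}. p j * wdist x' y xs ys
    + ((norm (yh j - ys j))\<^sup>2 - (norm (y j - ys j))\<^sup>2) / (2 * \<sigma> j)
    - A j (x' - xs) \<bullet> (yh j - y j) + \<gamma> * ((norm (yh j - y j))\<^sup>2 / (2 * \<sigma> j)))"
    unfolding defs using \<gamma> by (intro sum_mono lyap_update_le) auto
  also have "\<dots> = wdist x' y xs ys + (E1 - E2) - C + \<gamma> * E3"
    unfolding E1_def E2_def E3_def C_def
    by (simp only: sum.distrib sum_subtractf diff_divide_distrib sum_distrib_left[symmetric]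
        sum_distrib_right[symmetric] p_sum mult_1)
  finally have 1: "(\<Sum>j\<in>{1..n}. p j * lyap \<gamma> xs ys (update t j))
      \<le> wdist x' y xs ys + (E1 - E2) - C + \<gamma> * E3" .
  have 2: "0 \<le> ((norm (x - xs))\<^sup>2 - (norm (x' - xs))\<^sup>2 - (norm (x' - x))\<^sup>2) / (2 * \<tau>)
      + (E2 - E1 - E3) + C - q \<bullet> (x' - xs)"
    using one_step_inequality[OF t kkt] unfolding defs[symmetric] E1_def E2_def E3_def C_def
    by (simp only: sum_subtractf diff_divide_distrib)
  have w: "wdist x' y xs ys = wdist x y xs ys
      - ((norm (x - xs))\<^sup>2 - (norm (x' - xs))\<^sup>2 - (norm (x' - x))\<^sup>2) / (2 * \<tau>) - d"
    by (simp add: wdist_def d_def diff_divide_distrib)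
  have "(x - x') \<bullet> q \<le> (\<gamma> / \<tau>) / 2 * (norm (x - x'))\<^sup>2 + 1 / (2 * (\<gamma> / \<tau>)) * (norm q)\<^sup>2"
    using \<gamma>(1) tau_pos by (intro young_inner) simp
  also have "\<dots> = \<gamma> * d + \<tau> / (2 * \<gamma>) * (norm q)\<^sup>2"
    by (simp add: d_def norm_minus_commute)
  finally have 3: "(x - x') \<bullet> q \<le> \<gamma> * d + \<tau> / (2 * \<gamma>) * (norm q)\<^sup>2" .
  have 4: "q \<bullet> (x' - xs) = (x - xs) \<bullet> q - (x - x') \<bullet> q"
    by (simp add: inner_diff inner_commute)
  have 5: "decr \<gamma> t = (d - \<gamma> * d) + (E3 - \<gamma> * E3)"
    unfolding decr_def defs[symmetric] d_def[symmetric] E3_def[symmetric] by (simp add: algebra_simps)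
  have 6: "lyap \<gamma> xs ys t = wdist x y xs ys - (x - xs) \<bullet> q + \<tau> / (2 * \<gamma>) * (norm q)\<^sup>2"
    by (simp add: lyap_def defs)
  show ?thesis using 1 2 w 3 4 5 6 by linarith
qed

lemma wdist_y_nonneg: "0 \<le> (\<Sum>i\<in>{1..n}. (norm (y i - y' i))\<^sup>2 / (2 * \<sigma> i * p i))"
  using sigma_pos p_pos
  by (intro sum_nonneg divide_nonneg_nonneg mult_nonneg_nonneg) (auto simp: less_imp_le)

lemma wdist_nonneg: "0 \<le> wdist x y x' y'"
  unfolding wdist_def by (intro add_nonneg_nonneg wdist_y_nonneg) (use tau_pos in simp)

text \<open>The same Young inequality, now against the primal error, uses up the quadratic term and
  a fraction \<gamma> of the distance. Thus bounds on \<open>lyap\<close> become bounds on the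
  iterates.\<close>

lemma lyap_ge:
  assumes \<gamma>: "0 < \<gamma>"
  shows "(1 - \<gamma>) * wdist (fst t) (fst (snd t)) xs ys \<le> lyap \<gamma> xs ys t"
proof -
  define x y q where "x = fst t" and "y = fst (snd t)" and "q = extrap t"
  have "(x - xs) \<bullet> q \<le> (\<gamma> / \<tau>) / 2 * (norm (x - xs))\<^sup>2 + 1 / (2 * (\<gamma> / \<tau>)) * (norm q)\<^sup>2"
    using \<gamma> tau_pos by (intro young_inner) simp
  also have "\<dots> = \<gamma> * ((norm (x - xs))\<^sup>2 / (2 * \<tau>)) + \<tau> / (2 * \<gamma>) * (norm q)\<^sup>2"
    by simp
  also have "(norm (x - xs))\<^sup>2 / (2 * \<tau>) \<le> wdist x y xs ys"
    unfolding wdist_def using wdist_y_nonneg by simp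
  finally show ?thesis using \<gamma>
    by (simp add: lyap_def x_def[symmetric] y_def[symmetric] q_def[symmetric] algebra_simps)
qed

lemma wdist_commute: "wdist x y x' y' = wdist x' y' x y"
  by (simp add: wdist_def norm_minus_commute)

lemma wdist_triangle: "wdist x y x'' y'' \<le> 2 * wdist x y x' y' + 2 * wdist x' y' x'' y''"
proof -
  have 1: "(norm (x - x''))\<^sup>2 / (2 * \<tau>) \<le> 2 * ((norm (x - x'))\<^sup>2 / (2 * \<tau>)) + 2 * ((norm (x' - x''))\<^sup>2 / (2 * \<tau>))"
    using divide_right_mono[OF norm_diff_sq_le[of x x'' x'], of "2 * \<tau>"] tau_pos
    by (simp add: add_divide_distrib)
  have "(\<Sum>i\<in>{1..n}. (norm (y i - y'' i))\<^sup>2 / (2 * \<sigma> i * p i))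
      \<le> (\<Sum>i\<in>{1..n}. 2 * ((norm (y i - y' i))\<^sup>2 / (2 * \<sigma> i * p i)) + 2 * ((norm (y' i - y'' i))\<^sup>2 / (2 * \<sigma> i * p i)))"
  proof (rule sum_mono)
    fix i assume i: "i \<in> {1..n}"
    show "(norm (y i - y'' i))\<^sup>2 / (2 * \<sigma> i * p i)
      \<le> 2 * ((norm (y i - y' i))\<^sup>2 / (2 * \<sigma> i * p i)) + 2 * ((norm (y' i - y'' i))\<^sup>2 / (2 * \<sigma> i * p i))"
      using divide_right_mono[OF norm_diff_sq_le[of "y i" "y'' i" "y' i"], of "2 * \<sigma> i * p i"]
        sigma_pos[OF i] p_pos[OF i] by (simp add: add_divide_distrib)
  qed
  also have "\<dots> = 2 * (\<Sum>i\<in>{1..n}. (norm (y i - y' i))\<^sup>2 / (2 * \<sigma> i * p i))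
      + 2 * (\<Sum>i\<in>{1..n}. (norm (y' i - y'' i))\<^sup>2 / (2 * \<sigma> i * p i))"
    by (simp only: sum.distrib sum_distrib_left)
  finally have 2: "(\<Sum>i\<in>{1..n}. (norm (y i - y'' i))\<^sup>2 / (2 * \<sigma> i * p i))
      \<le> 2 * (\<Sum>i\<in>{1..n}. (norm (y i - y' i))\<^sup>2 / (2 * \<sigma> i * p i))
      + 2 * (\<Sum>i\<in>{1..n}. (norm (y' i - y'' i))\<^sup>2 / (2 * \<sigma> i * p i))" .
  from add_mono[OF 1 2] show ?thesis
    unfolding wdist_def distrib_left by (simp only: ac_simps)
qed

lemma wdist_ge_x: "(norm (x - x'))\<^sup>2 \<le> 2 * \<tau> * wdist x y x' y'"
proof -
  have "(norm (x - x'))\<^sup>2 / (2 * \<tau>) \<le> wdist x y x' y'"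
    unfolding wdist_def using wdist_y_nonneg by simp
  then show ?thesis using tau_pos by (simp add: divide_le_eq mult.commute)
qed

lemma wdist_ge_y:
  assumes i: "i \<in> {1..n}"
  shows "(norm (y i - y' i))\<^sup>2 \<le> 2 * \<sigma> i * p i * wdist x y x' y'"
proof -
  have "(norm (y i - y' i))\<^sup>2 / (2 * \<sigma> i * p i) \<le> (\<Sum>i\<in>{1..n}. (norm (y i - y' i))\<^sup>2 / (2 * \<sigma> i * p i))"
    by (rule member_le_sum[OF i]) (use sigma_pos p_pos in \<open>auto simp: less_imp_le\<close>)
  also have "\<dots> \<le> wdist x y x' y'" unfolding wdist_def using tau_pos by simp
  finally show ?thesis using sigma_pos[OF i] p_pos[OF i] by (simp add: divide_le_eq mult.commute)
qed

lemma wdist_tendsto: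
  assumes "(\<lambda>k. x k) \<longlonglongrightarrow> x'" "\<And>i. i \<in> {1..n} \<Longrightarrow> (\<lambda>k. y k i) \<longlonglongrightarrow> y' i"
  shows "(\<lambda>k. wdist (x k) (y k) xs ys) \<longlonglongrightarrow> wdist x' y' xs ys"
  unfolding wdist_def
  by (intro tendsto_intros assms) (use tau_pos sigma_pos p_pos in \<open>auto simp: less_imp_neq[symmetric]\<close>)

subsection \<open>Convergence of the iterates\<close>

lemma decr_ge_x:
  assumes "\<gamma> < 1"
  shows "(norm (x_next t - fst t))\<^sup>2 \<le> 2 * \<tau> / (1 - \<gamma>) * decr \<gamma> t"
proof -
  have "0 \<le> (\<Sum>i\<in>{1..n}. (norm (y_next t i - fst (snd t) i))\<^sup>2 / (2 * \<sigma> i))"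
    using sigma_pos by (intro sum_nonneg divide_nonneg_nonneg) (auto simp: less_imp_le)
  then have "(1 - \<gamma>) * ((norm (x_next t - fst t))\<^sup>2 / (2 * \<tau>)) \<le> decr \<gamma> t"
    unfolding decr_def using assms by (intro mult_left_mono) auto
  then show ?thesis using assms tau_pos by (simp add: field_simps)
qed

lemma decr_ge_y:
  assumes "\<gamma> < 1" and i: "i \<in> {1..n}"
  shows "(norm (y_next t i - fst (snd t) i))\<^sup>2 \<le> 2 * \<sigma> i / (1 - \<gamma>) * decr \<gamma> t"
proof -
  have "(norm (y_next t i - fst (snd t) i))\<^sup>2 / (2 * \<sigma> i)
      \<le> (\<Sum>i\<in>{1..n}. (norm (y_next t i - fst (snd t) i))\<^sup>2 / (2 * \<sigma> i))"
    by (rule member_le_sum[OF i]) (use sigma_pos in \<open>auto simp: less_imp_le\<close>)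
  moreover have "0 \<le> (norm (x_next t - fst t))\<^sup>2 / (2 * \<tau>)" using tau_pos by simp
  ultimately have "(1 - \<gamma>) * ((norm (y_next t i - fst (snd t) i))\<^sup>2 / (2 * \<sigma> i)) \<le> decr \<gamma> t"
    unfolding decr_def using assms by (intro mult_left_mono) auto
  then show ?thesis using assms sigma_pos[OF i] by (simp add: field_simps)
qed

lemma decr_nonneg:
  assumes "\<gamma> < 1"
  shows "0 \<le> decr \<gamma> t"
proof -
  have "0 \<le> 2 * \<tau> / (1 - \<gamma>) * decr \<gamma> t"
    using decr_ge_x[OF assms] order_trans zero_le_power2 by blast
  then show ?thesis using assms tau_pos by (simp add: zero_le_mult_iff zero_le_divide_iff)
qed

lemma contraction_factor:
  obtains \<gamma> where "0 < \<gamma>" "\<gamma> < 1" "\<forall>i\<in>{1..n}. \<tau> * \<sigma> i * (onorm (A i))\<^sup>2 \<le> \<gamma>\<^sup>2 * p i"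
proof -
  define r where "r i = \<tau> * \<sigma> i * (onorm (A i))\<^sup>2 / p i" for i
  \<comment> \<open>The extra candidate 1/2 keeps \<gamma>, the square root of \<open>m\<close>,
    positive even if all operators vanish; \<gamma> appears in denominators.\<close>
  define m where "m = Max (insert (1/2) (r ` {1..n}))"
  have fin: "finite (insert (1/2) (r ` {1..n}))" by simp
  have r1: "r i < 1" if "i \<in> {1..n}" for i
    using step_bound[OF that] p_pos[OF that] by (simp add: r_def)
  have m1: "m < 1" unfolding m_def using fin r1 by (subst Max_less_iff) auto
  have m2: "1/2 \<le> m" unfolding m_def using fin by (rule Max_ge) simp
  have "\<tau> * \<sigma> i * (onorm (A i))\<^sup>2 \<le> (sqrt m)\<^sup>2 * p i" if i: "i \<in> {1..n}" for i
  proof -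
    have "r i \<le> m" unfolding m_def using fin by (rule Max_ge) (use i in blast)
    then show ?thesis using p_pos[OF i] m2 by (simp add: r_def divide_le_eq)
  qed
  moreover have "0 < sqrt m" "sqrt m < 1" using m1 m2 by simp_all
  ultimately show thesis using that by blast
qed

section \<open>Deterministic convergence along one realisation\<close>

context
  fixes \<gamma> :: real and t :: "nat \<Rightarrow> 'x \<times> (nat \<Rightarrow> 'y) \<times> 'x \<times> 'x" and js :: "nat \<Rightarrow> nat"
  assumes \<gamma>: "0 < \<gamma>" "\<gamma> < 1"
    and t_reach: "\<And>k. t k \<in> reach"
    and t_Suc: "\<And>k. t (Suc k) = update (t k) (js k)"
    and js: "\<And>k. js k \<in> {1..n}"
    and decr_0: "(\<lambda>k. decr \<gamma> (t k)) \<longlonglongrightarrow> 0"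
begin

lemma x_next_diff_tendsto: "(\<lambda>k. x_next (t k) - fst (t k)) \<longlonglongrightarrow> 0"
  by (rule tendsto_0_of_norm_sq_le[OF decr_ge_x[OF \<gamma>(2)] tendsto_mult_right_zero[OF decr_0]])

lemma y_next_diff_tendsto:
  assumes i: "i \<in> {1..n}"
  shows "(\<lambda>k. y_next (t k) i - fst (snd (t k)) i) \<longlonglongrightarrow> 0"
  by (rule tendsto_0_of_norm_sq_le[OF decr_ge_y[OF \<gamma>(2) i] tendsto_mult_right_zero[OF decr_0]])

text \<open>The drawn index changes with time, so the extrapolation is dominated by the sum over all
  candidates, each of which tends to zero.\<close>

lemma extrap_tendsto: "(\<lambda>k. extrap (t k)) \<longlonglongrightarrow> 0"
proof -
  define v where "v i k = (1 / p i) *\<^sub>R adjoint (A i) (y_next (t k) i - fst (snd (t k)) i)" for i k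
  have v: "(\<lambda>k. norm (v i k)) \<longlonglongrightarrow> 0" if i: "i \<in> {1..n}" for i
    unfolding v_def
    by (rule tendsto_norm_zero, rule bounded_linear.tendsto_zero[OF bounded_linear_scaleR_right],
        rule bounded_linear.tendsto_zero[OF bounded_linear_adjoint[OF i] y_next_diff_tendsto[OF i]])
  have "(\<lambda>k. extrap (t (Suc k))) \<longlonglongrightarrow> 0"
  proof (rule Lim_null_comparison)
    show "\<forall>\<^sub>F k in sequentially. norm (extrap (t (Suc k))) \<le> (\<Sum>i\<in>{1..n}. norm (v i k))"
    proof (intro always_eventually allI)
      fix k
      have "extrap (t (Suc k)) = v (js k) k" by (simp add: t_Suc extrap_update v_def)
      then show "norm (extrap (t (Suc k))) \<le> (\<Sum>i\<in>{1..n}. norm (v i k))"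
        using member_le_sum[OF js[of k], of "\<lambda>i. norm (v i k)"] by simp
    qed
    show "(\<lambda>k. \<Sum>i\<in>{1..n}. norm (v i k)) \<longlonglongrightarrow> 0"
      using tendsto_sum[of "{1..n}" "\<lambda>i k. norm (v i k)" "\<lambda>_. 0"] v by simp
  qed
  then show ?thesis by (rule LIMSEQ_imp_Suc)
qed

text \<open>Old and new iterates share their limit along the subsequence and \<open>extrap\<close>
  vanishes, so the subgradients delivered by the proximal steps converge to \<open>- AT yh\<close>
  and \<open>A i xh\<close>.\<close>

lemma cluster_point_kkt:
  assumes r: "strict_mono r"
    and x: "(\<lambda>k. fst (t (r k))) \<longlonglongrightarrow> xh"
    and y: "\<And>i. i \<in> {1..n} \<Longrightarrow> (\<lambda>k. fst (snd (t (r k))) i) \<longlonglongrightarrow> yh i"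
  shows "kkt xh yh"
proof -
  have sub: "(\<lambda>k. u (r k)) \<longlonglongrightarrow> 0" if "u \<longlonglongrightarrow> 0" for u :: "nat \<Rightarrow> 'b::real_normed_vector"
    using LIMSEQ_subseq_LIMSEQ[OF that r] by (simp add: comp_def)
  have x': "(\<lambda>k. x_next (t (r k))) \<longlonglongrightarrow> xh"
    using tendsto_add[OF sub[OF x_next_diff_tendsto] x] by simp
  have y': "(\<lambda>k. y_next (t (r k)) i) \<longlonglongrightarrow> yh i" if "i \<in> {1..n}" for i
    using tendsto_add[OF sub[OF y_next_diff_tendsto[OF that]] y[OF that]] by simp
  define zb where "zb k = snd (snd (snd (t (r k))))" for k
  have zb_eq: "zb = (\<lambda>k. AT (fst (snd (t (r k)))) + extrap (t (r k)))"
    using t_reach by (auto simp: zb_def extrap_def reach_def)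
  have "(\<lambda>k. AT (fst (snd (t (r k))))) \<longlonglongrightarrow> AT yh" by (rule AT_tendsto) (rule y)
  from tendsto_add[OF this sub[OF extrap_tendsto]] have zb: "zb \<longlonglongrightarrow> AT yh"
    unfolding zb_eq by simp
  have "subgrad_on UNIV g xh (- AT yh)"
  proof (rule subgrad_on_closed[OF closed_UNIV g_proper g_lsc _ x'])
    show "subgrad_on UNIV g (x_next (t (r k)))
        ((1 / \<tau>) *\<^sub>R ((fst (t (r k)) - \<tau> *\<^sub>R zb k) - x_next (t (r k))))" for k
      unfolding x_next_def zb_def by (rule g_prox)
    have "(\<lambda>k. (1 / \<tau>) *\<^sub>R ((fst (t (r k)) - \<tau> *\<^sub>R zb k) - x_next (t (r k))))
        \<longlonglongrightarrow> (1 / \<tau>) *\<^sub>R ((xh - \<tau> *\<^sub>R AT yh) - xh)"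
      by (intro tendsto_intros x x' zb)
    then show "(\<lambda>k. (1 / \<tau>) *\<^sub>R ((fst (t (r k)) - \<tau> *\<^sub>R zb k) - x_next (t (r k)))) \<longlonglongrightarrow> - AT yh"
      using tau_pos by simp
  qed
  moreover have "subgrad_on (S i) (h i) (yh i) (A i xh)" if i: "i \<in> {1..n}" for i
  proof (rule subgrad_on_closed[OF closed_subspace[OF subsp[OF i]] h_proper[OF i] h_lsc[OF i] _ y'[OF i]])
    show "subgrad_on (S i) (h i) (y_next (t (r k)) i)
        ((1 / \<sigma> i) *\<^sub>R ((fst (snd (t (r k))) i + \<sigma> i *\<^sub>R A i (x_next (t (r k)))) - y_next (t (r k)) i))" for k
      unfolding y_next_def by (rule h_prox[OF i])
    have "bounded_linear (A i)" using linA[OF i] by (simp add: linear_conv_bounded_linear)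
    then have "(\<lambda>k. (1 / \<sigma> i) *\<^sub>R ((fst (snd (t (r k))) i + \<sigma> i *\<^sub>R A i (x_next (t (r k)))) - y_next (t (r k)) i))
        \<longlonglongrightarrow> (1 / \<sigma> i) *\<^sub>R ((yh i + \<sigma> i *\<^sub>R A i xh) - yh i)"
      by (intro tendsto_intros bounded_linear.tendsto[of "A i"] x' y' y i)
    then show "(\<lambda>k. (1 / \<sigma> i) *\<^sub>R ((fst (snd (t (r k))) i + \<sigma> i *\<^sub>R A i (x_next (t (r k)))) - y_next (t (r k)) i))
        \<longlonglongrightarrow> A i xh"
      using sigma_pos[OF i] by simp
  qed
  ultimately show ?thesis by (simp add: kkt_def)
qed

lemma iterates_bounded:
  assumes "convergent (\<lambda>k. lyap \<gamma> xs ys (t k))"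
  shows "bounded (range (\<lambda>k. fst (t k)))"
    and "i \<in> {1..n} \<Longrightarrow> bounded (range (\<lambda>k. fst (snd (t k)) i))"
proof -
  obtain B where B: "\<And>k. lyap \<gamma> xs ys (t k) \<le> B"
    using convergent_imp_Bseq[OF assms] unfolding Bseq_def by (metis abs_le_D1 real_norm_def)
  define C where "C = B / (1 - \<gamma>)"
  have w: "wdist (fst (t k)) (fst (snd (t k))) xs ys \<le> C" for k
    using order_trans[OF lyap_ge[OF \<gamma>(1)] B[of k]] \<gamma>(2)
    by (simp add: C_def le_divide_eq mult.commute)
  have "norm (fst (t k)) \<le> norm xs + sqrt (2 * \<tau> * C)" for k
  proof -
    have "(norm (fst (t k) - xs))\<^sup>2 \<le> 2 * \<tau> * C"
      by (rule order_trans[OF wdist_ge_x mult_left_mono[OF w[of k]]]) (use tau_pos in simp)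
    then have "norm (fst (t k) - xs) \<le> sqrt (2 * \<tau> * C)" by (rule real_le_rsqrt)
    then show ?thesis using norm_triangle_sub[of "fst (t k)" xs] by simp
  qed
  then show "bounded (range (\<lambda>k. fst (t k)))" unfolding bounded_iff by blast
  assume i: "i \<in> {1..n}"
  have "norm (fst (snd (t k)) i) \<le> norm (ys i) + sqrt (2 * \<sigma> i * p i * C)" for k
  proof -
    have "(norm (fst (snd (t k)) i - ys i))\<^sup>2 \<le> 2 * \<sigma> i * p i * C"
      by (rule order_trans[OF wdist_ge_y[OF i] mult_left_mono[OF w[of k]]])
        (use sigma_pos[OF i] p_pos[OF i] in simp)
    then have "norm (fst (snd (t k)) i - ys i) \<le> sqrt (2 * \<sigma> i * p i * C)" by (rule real_le_rsqrt)
    then show ?thesis using norm_triangle_sub[of "fst (snd (t k)) i" "ys i"] by simp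
  qed
  then show "bounded (range (\<lambda>k. fst (snd (t k)) i))" unfolding bounded_iff by blast
qed

text \<open>With bounded primal iterates and vanishing \<open>extrap\<close>, the two correction
  terms of \<open>lyap\<close> tend to zero.\<close>

lemma wdist_convergent:
  assumes "convergent (\<lambda>k. lyap \<gamma> xs ys (t k))"
  shows "convergent (\<lambda>k. wdist (fst (t k)) (fst (snd (t k))) xs ys)"
proof -
  obtain l where l: "(\<lambda>k. lyap \<gamma> xs ys (t k)) \<longlonglongrightarrow> l" using assms by (auto simp: convergent_def)
  obtain B where B: "\<And>k. norm (fst (t k)) \<le> B"
    using iterates_bounded(1)[OF assms] unfolding bounded_iff by blast
  have "(\<lambda>k. (fst (t k) - xs) \<bullet> extrap (t k)) \<longlonglongrightarrow> 0"
  proof (rule Lim_null_comparison)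
    show "\<forall>\<^sub>F k in sequentially. norm ((fst (t k) - xs) \<bullet> extrap (t k)) \<le> (B + norm xs) * norm (extrap (t k))"
    proof (intro always_eventually allI)
      fix k
      have "norm (fst (t k) - xs) \<le> B + norm xs"
        using norm_triangle_ineq4[of "fst (t k)" xs] B[of k] by simp
      then have "norm (fst (t k) - xs) * norm (extrap (t k)) \<le> (B + norm xs) * norm (extrap (t k))"
        by (rule mult_right_mono) simp
      then show "norm ((fst (t k) - xs) \<bullet> extrap (t k)) \<le> (B + norm xs) * norm (extrap (t k))"
        using Cauchy_Schwarz_ineq2[of "fst (t k) - xs" "extrap (t k)"] by simp
    qed
    show "(\<lambda>k. (B + norm xs) * norm (extrap (t k))) \<longlonglongrightarrow> 0"
      by (rule tendsto_mult_right_zero[OF tendsto_norm_zero[OF extrap_tendsto]])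
  qed
  then have "(\<lambda>k. lyap \<gamma> xs ys (t k) + (fst (t k) - xs) \<bullet> extrap (t k)
      - \<tau> / (2 * \<gamma>) * (norm (extrap (t k)))\<^sup>2) \<longlonglongrightarrow> l + 0 - \<tau> / (2 * \<gamma>) * (norm (0::'x))\<^sup>2"
    by (intro tendsto_intros l extrap_tendsto)
  then show ?thesis by (auto simp: lyap_def convergent_def)
qed

text \<open>An Opial-type argument. The cluster point need not belong to \<open>D\<close>, so its
  own distance is not known to converge; a nearby point of \<open>D\<close> stands in for
  it.\<close>

lemma iterates_converge:
  assumes D: "D \<subseteq> {(x, y). kkt x y}" "{(x, y). kkt x y} \<subseteq> closure D"
    and ne: "{(x, y). kkt x y} \<noteq> {}"
    and conv: "\<forall>s\<in>D. convergent (\<lambda>k. lyap \<gamma> (fst s) (snd s) (t k))"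
  shows "\<exists>xh yh. kkt xh yh \<and> (\<lambda>k. fst (t k)) \<longlonglongrightarrow> xh
    \<and> (\<forall>i\<in>{1..n}. (\<lambda>k. fst (snd (t k)) i) \<longlonglongrightarrow> yh i)"
proof -
  have "D \<noteq> {}" using D(2) ne by auto
  then obtain s0 where "s0 \<in> D" by blast
  then have conv0: "convergent (\<lambda>k. lyap \<gamma> (fst s0) (snd s0) (t k))" using conv by blast
  obtain r1 xh where r1: "strict_mono r1" "((\<lambda>k. fst (t k)) \<circ> r1) \<longlonglongrightarrow> xh"
    using bounded_imp_convergent_subsequence[OF iterates_bounded(1)[OF conv0]] by blast
  have "bounded (range (\<lambda>k. fst (snd (t (r1 k))) i))" if "i \<in> {1..n}" for i
    by (rule bounded_subset[OF iterates_bounded(2)[OF conv0 that]]) auto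
  then obtain r2 yh where r2: "strict_mono r2"
    "\<forall>i\<in>{1..n}. (\<lambda>k. fst (snd (t (r1 (r2 k)))) i) \<longlonglongrightarrow> yh i"
    using common_convergent_subseq[of "{1..n}" "\<lambda>i k. fst (snd (t (r1 k))) i"] by auto
  define r where "r = r1 \<circ> r2"
  have r: "strict_mono r" unfolding r_def using r1(1) r2(1) by (rule strict_mono_o)
  have x: "(\<lambda>k. fst (t (r k))) \<longlonglongrightarrow> xh"
    using LIMSEQ_subseq_LIMSEQ[OF r1(2) r2(1)] by (simp add: r_def comp_def)
  have y: "(\<lambda>k. fst (snd (t (r k))) i) \<longlonglongrightarrow> yh i" if "i \<in> {1..n}" for i
    using r2(2) that by (simp add: r_def)
  have kkt: "kkt xh yh" by (rule cluster_point_kkt[OF r x y])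
  define d where "d xs ys k = wdist (fst (t k)) (fst (snd (t k))) xs ys" for xs ys k
  obtain s where s: "\<And>m. s m \<in> D" "s \<longlonglongrightarrow> (xh, yh)"
    using kkt D(2) closure_sequential by blast
  have s_y: "(\<lambda>m. snd (s m) i) \<longlonglongrightarrow> yh i" for i
  proof -
    have "isCont (\<lambda>y::nat \<Rightarrow> 'y. y i) yh"
      by (rule continuous_on_interior[OF continuous_on_product_coordinates[of i]]) simp
    then show ?thesis using isCont_tendsto_compose[OF _ tendsto_snd[OF s(2)]] by fastforce
  qed
  have s_x: "(\<lambda>m. fst (s m)) \<longlonglongrightarrow> xh" using tendsto_fst[OF s(2)] by simp
  have "(\<lambda>m. wdist (fst (s m)) (snd (s m)) xh yh) \<longlonglongrightarrow> wdist xh yh xh yh"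
    by (rule wdist_tendsto[OF s_x s_y])
  then have s_0: "(\<lambda>m. wdist (fst (s m)) (snd (s m)) xh yh) \<longlonglongrightarrow> 0"
    by (simp add: wdist_def)
  have "(\<lambda>k. d xh yh k) \<longlonglongrightarrow> 0"
  proof (rule LIMSEQ_I)
    fix \<epsilon> :: real assume \<epsilon>: "0 < \<epsilon>"
    \<comment> \<open>Two distances below a quarter of \<epsilon>, each doubled by
      \<open>wdist_triangle\<close>, add up to less than \<epsilon>.\<close>
    then obtain m where "norm (wdist (fst (s m)) (snd (s m)) xh yh - 0) < \<epsilon> / 4"
      using LIMSEQ_D[OF s_0, of "\<epsilon> / 4"] by auto
    then have m: "wdist (fst (s m)) (snd (s m)) xh yh < \<epsilon> / 4" by simp
    obtain l where l: "(\<lambda>k. d (fst (s m)) (snd (s m)) k) \<longlonglongrightarrow> l"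
      using wdist_convergent conv s(1)[of m] unfolding d_def convergent_def by blast
    have "(\<lambda>k. d (fst (s m)) (snd (s m)) (r k)) \<longlonglongrightarrow> wdist xh yh (fst (s m)) (snd (s m))"
      unfolding d_def by (rule wdist_tendsto[OF x y])
    moreover have "(\<lambda>k. d (fst (s m)) (snd (s m)) (r k)) \<longlonglongrightarrow> l"
      using LIMSEQ_subseq_LIMSEQ[OF l r] by (simp add: comp_def)
    \<comment> \<open>Along \<open>r\<close> the iterates approach the cluster point, so the limit
      along the whole sequence is the small distance from the cluster point to
      \<open>s m\<close>.\<close>
    ultimately have "l = wdist xh yh (fst (s m)) (snd (s m))"
      using LIMSEQ_unique by blast
    also have "\<dots> = wdist (fst (s m)) (snd (s m)) xh yh" by (rule wdist_commute)
    finally have "\<forall>\<^sub>F k in sequentially. d (fst (s m)) (snd (s m)) k < \<epsilon> / 4"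
      using order_tendstoD(2)[OF l, of "\<epsilon> / 4"] m by simp
    then obtain N where N: "\<And>k. N \<le> k \<Longrightarrow> d (fst (s m)) (snd (s m)) k < \<epsilon> / 4"
      by (auto simp: eventually_sequentially)
    have "norm (d xh yh k - 0) < \<epsilon>" if k: "N \<le> k" for k
    proof -
      have "d xh yh k \<le> 2 * d (fst (s m)) (snd (s m)) k + 2 * wdist (fst (s m)) (snd (s m)) xh yh"
        unfolding d_def by (rule wdist_triangle)
      moreover have "0 \<le> d xh yh k" unfolding d_def by (rule wdist_nonneg)
      ultimately show ?thesis using N[OF k] m by simp
    qed
    then show "\<exists>N. \<forall>k\<ge>N. norm (d xh yh k - 0) < \<epsilon>" by blast
  qed
  then have cd: "(\<lambda>k. c * d xh yh k) \<longlonglongrightarrow> 0" for c by (rule tendsto_mult_right_zero)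
  have "(\<lambda>k. fst (t k) - xh) \<longlonglongrightarrow> 0"
    by (rule tendsto_0_of_norm_sq_le[OF _ cd]) (unfold d_def, rule wdist_ge_x)
  then have 1: "(\<lambda>k. fst (t k)) \<longlonglongrightarrow> xh" by (rule LIM_zero_cancel)
  have 2: "(\<lambda>k. fst (snd (t k)) i) \<longlonglongrightarrow> yh i" if i: "i \<in> {1..n}" for i
  proof -
    have "(\<lambda>k. fst (snd (t k)) i - yh i) \<longlonglongrightarrow> 0"
      by (rule tendsto_0_of_norm_sq_le[OF _ cd]) (unfold d_def, rule wdist_ge_y[OF i])
    then show ?thesis by (rule LIM_zero_cancel)
  qed
  show ?thesis using kkt 1 2 by blast
qed

end

end

theorem theorem1:
  fixes n :: nat
    and S :: "nat \<Rightarrow> 'y::euclidean_space set"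
    and A :: "nat \<Rightarrow> 'x::euclidean_space \<Rightarrow> 'y"
    and g :: "'x \<Rightarrow> ereal"
    and f :: "nat \<Rightarrow> 'y \<Rightarrow> ereal"
    and p :: "nat \<Rightarrow> real" and \<tau> :: real and \<sigma> :: "nat \<Rightarrow> real" and x0 :: 'x
    and M :: "'\<omega> measure" and J :: "nat \<Rightarrow> '\<omega> \<Rightarrow> nat"
  assumes subsp: "\<forall>i\<in>{1..n}. subspace (S i)"
    and lin: "\<forall>i\<in>{1..n}. linear (A i) \<and> (\<forall>x. A i x \<in> S i)"
    and g_cvx: "ext_convex_on UNIV g" and g_proper: "proper_on UNIV g" and g_lsc: "lsc_on UNIV g"
    and f_cvx: "\<forall>i\<in>{1..n}. ext_convex_on (S i) (f i)"
    and f_proper: "\<forall>i\<in>{1..n}. proper_on (S i) (f i)"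
    and f_lsc: "\<forall>i\<in>{1..n}. lsc_on (S i) (f i)"
    and p_pos: "\<forall>i\<in>{1..n}. p i > 0" and p_sum: "(\<Sum>i\<in>{1..n}. p i) = 1"
    and tau_pos: "\<tau> > 0" and sigma_pos: "\<forall>i\<in>{1..n}. \<sigma> i > 0"
    and step: "\<forall>i\<in>{1..n}. \<tau> * \<sigma> i * (onorm (A i))\<^sup>2 < p i"
    and saddle_exists: "\<exists>xh yh. saddle_point n S A g f xh yh"
    and prob: "prob_space M"
    and J_meas: "\<forall>k. J k \<in> measurable M (count_space UNIV)"
    and J_indep: "prob_space.indep_vars M (\<lambda>_. count_space UNIV) J UNIV"
    and J_distr: "\<forall>k. \<forall>i\<in>{1..n}. measure M {\<omega> \<in> space M. J k \<omega> = i} = p i"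
  shows "AE \<omega> in M. \<exists>xh yh. saddle_point n S A g f xh yh \<and>
           (\<lambda>k. fst (spdhg S A g f p \<tau> \<sigma> x0 (\<lambda>k. J k \<omega>) k)) \<longlonglongrightarrow> xh \<and>
           (\<forall>i\<in>{1..n}. (\<lambda>k. fst (snd (spdhg S A g f p \<tau> \<sigma> x0 (\<lambda>k. J k \<omega>) k)) i) \<longlonglongrightarrow> yh i)"
proof -
  interpret spdhg_problem n S A g f p \<tau> \<sigma>
    by (rule spdhg_problem.intro) (use subsp lin g_cvx g_proper g_lsc f_cvx f_proper f_lsc p_pos p_sum tau_pos
      sigma_pos step in blast)+
  interpret prob_space M by (rule prob)
  interpret random_iteration M J "{1..n}" p
    by unfold_locales (use J_indep J_distr p_sum in \<open>blast | simp\<close>)+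
  let ?s = "(x0, (\<lambda>i. 0), 0, 0) :: 'x \<times> (nat \<Rightarrow> 'y) \<times> 'x \<times> 'x"
  let ?K = "{(x, y). kkt x y}"
  obtain \<gamma> where \<gamma>: "0 < \<gamma>" "\<gamma> < 1" "\<forall>i\<in>{1..n}. \<tau> * \<sigma> i * (onorm (A i))\<^sup>2 \<le> \<gamma>\<^sup>2 * p i"
    by (rule contraction_factor)
  \<comment> \<open>Density refers to the product topology on primal points and functions of the
    index, which is second countable because the index type is countable.\<close>
  obtain D where D: "countable D" "D \<subseteq> ?K" "?K \<subseteq> closure D"
    using countable_dense_subset by blast
  have ne: "?K \<noteq> {}" using saddle_exists saddle_imp_kkt by blast
  have inv: "\<forall>t\<in>reach. \<forall>i\<in>{1..n}. update t i \<in> reach" using reach_update by blast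
  have decr_nn: "\<forall>t\<in>reach. 0 \<le> decr \<gamma> t" using decr_nonneg[OF \<gamma>(2)] by blast
  have lyap_nn: "\<forall>t\<in>reach. 0 \<le> lyap \<gamma> xs ys t" for xs ys
  proof
    fix t
    show "0 \<le> lyap \<gamma> xs ys t"
      by (rule order_trans[OF _ lyap_ge[OF \<gamma>(1)]]) (use \<gamma>(2) wdist_nonneg in simp)
  qed
  have drift: "\<forall>t\<in>reach. (\<Sum>j\<in>{1..n}. p j * lyap \<gamma> xs ys (update t j)) + decr \<gamma> t \<le> lyap \<gamma> xs ys t"
    if "kkt xs ys" for xs ys
    using lyap_drift[OF _ that \<gamma>(1,3)] by blast
  have "AE \<omega> in M. convergent (\<lambda>k. lyap \<gamma> (fst s) (snd s) (st update ?s k \<omega>))" if "s \<in> D" for s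
  proof (rule AE_W_convergent[OF reach_init inv lyap_nn])
    have "kkt (fst s) (snd s)" using that D(2) by auto
    then show "\<forall>t\<in>reach. (\<Sum>j\<in>{1..n}. p j * lyap \<gamma> (fst s) (snd s) (update t j)) \<le> lyap \<gamma> (fst s) (snd s) t"
      using drift decr_nn by (meson add_increasing2 order_refl order_trans)
  qed
  then have "AE \<omega> in M. \<forall>s\<in>D. convergent (\<lambda>k. lyap \<gamma> (fst s) (snd s) (st update ?s k \<omega>))"
    using D(1) by (simp add: AE_ball_countable)
  moreover have "AE \<omega> in M. (\<lambda>k. decr \<gamma> (st update ?s k \<omega>)) \<longlonglongrightarrow> 0"
  proof -
    \<comment> \<open>One saddle point suffices here, since \<open>decr\<close> does not depend on
      it.\<close>
    obtain xs ys where "kkt xs ys" using ne by blast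
    then show ?thesis using AE_D_tendsto_0[OF reach_init inv lyap_nn decr_nn drift] by blast
  qed
  moreover have "AE \<omega> in M. \<forall>k. st update ?s k \<omega> \<in> reach"
    by (rule AE_st_invariant[OF reach_init inv])
  ultimately show ?thesis using AE_J_mem
  proof eventually_elim
    case (elim \<omega>)
    have "\<exists>xh yh. kkt xh yh \<and> (\<lambda>k. fst (st update ?s k \<omega>)) \<longlonglongrightarrow> xh
        \<and> (\<forall>i\<in>{1..n}. (\<lambda>k. fst (snd (st update ?s k \<omega>)) i) \<longlonglongrightarrow> yh i)"
      by (rule iterates_converge[where js = "\<lambda>k. J k \<omega>", OF \<gamma>(1,2) _ _ _ elim(2) D(2,3) ne elim(1)])
        (use elim in auto)
    then show ?case unfolding spdhg_eq_iterate using kkt_imp_saddle by blast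
  qed
qed

end
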